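(* As $k\to\infty$, $$R(3,k)\ \ge\ \left(\frac{1}{200}+o(1)\right)\frac{k^2}{\log k}.$$
   Context: For positive integers $\ell,k$, the Ramsey number $R(\ell,k)$ is the least $N$ such that every (simple, undirected) graph on $N$ vertices contains either a clique of size $\ell$ or an independent set of size $k$. Here $\log$ is the natural logarithm and $o(1)$ denotes a quantity tending to $0$ as $k\to\infty$. *)

theory Defs
  imports Complex_Main "HOL-Library.Ramsey"
begin

text \<open>A simple undirected graph is a finite vertex set \<open>V\<close> together with an edge set
  \<open>E \<subseteq> [V]\<^bsup>2\<^esup>\<close>, i.e. a set of two-element subsets of \<open>V\<close>; cliques and independent sets
  are those of \<^theory>\<open>HOL-Library.Ramsey\<close>. Taking the vertices to be natural numbers
  loses no generality, since every finite graph is isomorphic to such a graph.\<close>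

definition ramsey_bound :: "nat \<Rightarrow> nat \<Rightarrow> nat \<Rightarrow> bool" where
  "ramsey_bound l k N \<longleftrightarrow>
     (\<forall>(V :: nat set) E. finite V \<longrightarrow> card V = N \<longrightarrow> E \<subseteq> [V]\<^bsup>2\<^esup> \<longrightarrow>
        (\<exists>R\<subseteq>V. card R = l \<and> clique R E \<or> card R = k \<and> indep R E))"

definition ramsey_number :: "nat \<Rightarrow> nat \<Rightarrow> nat" where
  "ramsey_number l k = (LEAST N. ramsey_bound l k N)"

text \<open>The minimum is attained, so \<open>LEAST\<close> does not return an unspecified value.\<close>

lemma ramsey_bound_ramsey_number: "ramsey_bound l k (ramsey_number l k)"
proof -
  obtain r where r: "\<And>(V :: nat set) E. finite V \<Longrightarrow> card V \<ge> r \<Longrightarrow>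
      \<exists>R\<subseteq>V. card R = l \<and> clique R E \<or> card R = k \<and> indep R E"
    using ramsey2[where ?'a = nat, of l k] by metis
  have "ramsey_bound l k r"
    unfolding ramsey_bound_def using r by simp
  then show ?thesis
    unfolding ramsey_number_def by (rule LeastI)
qed

end

theory Submission
  imports Defs "HOL-Analysis.Convex" "HOL-Real_Asymp.Real_Asymp"
begin

text \<open>The construction blows up two sparse random graphs and takes their union. The vertices are
  \<open>n\<close> points \<open>(x, y)\<close> of a grid \<open>[s] \<times> [s]\<close>, chosen at random so that \<open>k\<close> of them always have
  at least \<open>a = 9k/20\<close> distinct first coordinates or \<open>a\<close> distinct second coordinates. Take independent random
  graphs \<open>G\<close>, \<open>H\<close> on \<open>[s]\<close> of density \<open>p\<close>, with \<open>s p\<^sup>2\<close> tending to 0, and delete from each the edges of a maximal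
  family of edge-disjoint triangles. Two points are joined by a red edge if their first coordinates are
  adjacent in the remainder of \<open>G\<close> and their second coordinates have no common neighbour in \<open>H\<close>;
  blue edges are defined with the roles of \<open>G\<close> and \<open>H\<close> exchanged. The union is triangle-free.

  For independence, consider \<open>a\<close> points \<open>S\<close> with distinct first coordinates. A positive proportion of the pairs in
  \<open>S\<close> is open, i.e. the second coordinates have no common neighbour in \<open>H\<close>: a vertex \<open>z\<close> of \<open>H\<close> closes the pairs
  inside the set of those points of \<open>S\<close> that it hits. Since codegrees in \<open>H\<close> are bounded, the large ones
  among these sets are nearly disjoint, and each has at most about \<open>3k/16\<close> points; the small ones are controlled
  by an exponential moment. Openness depends on \<open>H\<close> only, hence given \<open>H\<close> the graph \<open>G\<close> misses all open
  pairs, up to deleted triangles, with probability about \<open>exp (- p m / 2)\<close>, where \<open>m\<close> is the number of ordered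
  open pairs. This beats the number of choices for \<open>S\<close>, which is at most \<open>n\<^sup>a\<close>.\<close>

section \<open>Random subsets\<close>

text \<open>The random subset of \<open>I\<close> that contains each element independently with probability \<open>p\<close>.\<close>

definition weight :: "real \<Rightarrow> 'a set \<Rightarrow> 'a set \<Rightarrow> real" where
  "weight p I E = p ^ card E * (1 - p) ^ card (I - E)"

definition expec :: "real \<Rightarrow> 'a set \<Rightarrow> ('a set \<Rightarrow> real) \<Rightarrow> real" where
  "expec p I f = (\<Sum>E\<in>Pow I. weight p I E * f E)"

definition prob :: "real \<Rightarrow> 'a set \<Rightarrow> ('a set \<Rightarrow> bool) \<Rightarrow> real" where
  "prob p I Q = expec p I (\<lambda>E. of_bool (Q E))"

lemma weight_nonneg: "0 \<le> p \<Longrightarrow> p \<le> 1 \<Longrightarrow> 0 \<le> weight p I E"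
  by (simp add: weight_def)

text \<open>Expanding the product of sums means deciding for each element of \<open>I\<close>
  whether it lies in \<open>E\<close>. This one identity yields the total mass, the exponential
  moments and the probability of prescribed presence and absence.\<close>

lemma expec_prod:
  assumes "finite I"
  shows "expec p I (\<lambda>E. (\<Prod>e\<in>E. h e) * (\<Prod>e\<in>I - E. g e)) = (\<Prod>e\<in>I. p * h e + (1 - p) * g e)"
  unfolding expec_def using assms
  by (subst prod_add) (auto simp: weight_def prod.distrib mult_ac intro!: sum.cong)

lemma expec_prod':
  assumes "finite I"
  shows "expec p I (\<lambda>E. \<Prod>e\<in>E. h e) = (\<Prod>e\<in>I. p * h e + (1 - p))"
  using expec_prod[OF assms, of p h "\<lambda>_. 1"] by simp

lemma expec_const: "finite I \<Longrightarrow> expec p I (\<lambda>_. c) = c"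
proof -
  assume "finite I"
  from expec_prod'[OF this, of p "\<lambda>_. 1"] have "expec p I (\<lambda>_. 1) = 1" by simp
  then show ?thesis by (simp add: expec_def flip: sum_distrib_right)
qed

lemma expec_mono:
  assumes "0 \<le> p" "p \<le> 1" "\<And>E. E \<subseteq> I \<Longrightarrow> f E \<le> g E"
  shows "expec p I f \<le> expec p I g"
  unfolding expec_def using assms by (auto intro!: sum_mono mult_left_mono weight_nonneg)

lemma expec_cong: "(\<And>E. E \<subseteq> I \<Longrightarrow> f E = g E) \<Longrightarrow> expec p I f = expec p I g"
  unfolding expec_def by (auto intro!: sum.cong)

lemma expec_cmult: "expec p I (\<lambda>E. c * f E) = c * expec p I f"
  by (simp add: expec_def sum_distrib_left mult_ac)

lemma expec_add: "expec p I (\<lambda>E. f E + g E) = expec p I f + expec p I g"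
  by (simp add: expec_def sum.distrib algebra_simps)

lemma expec_sum: "expec p I (\<lambda>E. \<Sum>i\<in>A. f i E) = (\<Sum>i\<in>A. expec p I (f i))"
  unfolding expec_def by (subst sum.swap) (simp add: sum_distrib_left)

lemma expec_nonneg:
  assumes "0 \<le> p" "p \<le> 1" "\<And>E. E \<subseteq> I \<Longrightarrow> 0 \<le> f E"
  shows "0 \<le> expec p I f"
  unfolding expec_def using assms by (auto intro!: sum_nonneg mult_nonneg_nonneg weight_nonneg)

text \<open>Independence of disjoint parts: \<open>E\<close> corresponds to the pair of its traces
  on \<open>I\<close> and \<open>J\<close>, and the weight factorises under this bijection.\<close>

lemma expec_split:
  assumes "finite I" "finite J" "I \<inter> J = {}"
  shows "expec p (I \<union> J) (\<lambda>E. f (E \<inter> I) * g (E \<inter> J)) = expec p I f * expec p J g"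
proof -
  have "expec p I f * expec p J g = (\<Sum>(A, B)\<in>Pow I \<times> Pow J. (weight p I A * f A) * (weight p J B * g B))"
    by (simp add: expec_def sum_product sum.cartesian_product)
  also have "\<dots> = (\<Sum>E\<in>Pow (I \<union> J). weight p (I \<union> J) E * (f (E \<inter> I) * g (E \<inter> J)))"
  proof (rule sum.reindex_bij_witness[of _ "\<lambda>E. (E \<inter> I, E \<inter> J)" "\<lambda>(A, B). A \<union> B"], goal_cases)
    case (1 x)
    then show ?case using assms by auto
  next
    case (2 x)
    then show ?case using assms by auto
  next
    case (3 E)
    then show ?case using assms by auto
  next
    case (4 E)
    then show ?case using assms by auto
  next
    case (5 x)
    then obtain A B where x: "x = (A, B)" and A: "A \<subseteq> I" and B: "B \<subseteq> J" by auto
    have fin: "finite A" "finite B" using A B assms by (auto intro: finite_subset)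
    have e: "(A \<union> B) \<inter> I = A" "(A \<union> B) \<inter> J = B" "A \<inter> B = {}" using A B assms by auto
    have "I \<union> J - (A \<union> B) = (I - A) \<union> (J - B)" "(I - A) \<inter> (J - B) = {}" using A B assms by auto
    then have "card (I \<union> J - (A \<union> B)) = card (I - A) + card (J - B)"
      using assms by (simp add: card_Un_disjoint)
    moreover have "card (A \<union> B) = card A + card B"
      using fin e by (simp add: card_Un_disjoint)
    ultimately show ?case
      unfolding x by (simp add: e weight_def power_add)
  qed
  finally show ?thesis by (simp add: expec_def)
qed

lemma expec_restrict:
  assumes "finite I" "J \<subseteq> I"
  shows "expec p I (\<lambda>E. f (E \<inter> J)) = expec p J f"
  using expec_split[of J "I - J" p f "\<lambda>_. 1"] assms finite_subset[of J I]
  by (simp add: expec_const Un_absorb1)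

lemma expec_prod_disjoint:
  assumes "finite Z" "\<And>z. z \<in> Z \<Longrightarrow> finite (I z)"
    and "\<And>z z'. z \<in> Z \<Longrightarrow> z' \<in> Z \<Longrightarrow> z \<noteq> z' \<Longrightarrow> I z \<inter> I z' = {}"
  shows "expec p (\<Union>z\<in>Z. I z) (\<lambda>E. \<Prod>z\<in>Z. f z (E \<inter> I z)) = (\<Prod>z\<in>Z. expec p (I z) (f z))"
  using assms
proof (induction Z)
  case empty
  then show ?case by (simp add: expec_const)
next
  case (insert z Z)
  let ?J = "\<Union>z\<in>Z. I z"
  have "expec p (\<Union>z\<in>insert z Z. I z) (\<lambda>E. \<Prod>z\<in>insert z Z. f z (E \<inter> I z))
    = expec p (I z \<union> ?J) (\<lambda>E. f z (E \<inter> I z) * (\<lambda>F. \<Prod>z\<in>Z. f z (F \<inter> I z)) (E \<inter> ?J))"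
  proof -
    have "(\<Prod>z\<in>Z. f z (E \<inter> I z)) = (\<Prod>z\<in>Z. f z (E \<inter> ?J \<inter> I z))" for E
      by (rule prod.cong) (auto intro!: arg_cong2[where f = f] simp: inf_absorb2 Int_assoc)
    then show ?thesis using insert.hyps by simp
  qed
  also have "\<dots> = expec p (I z) (f z) * expec p ?J (\<lambda>F. \<Prod>z\<in>Z. f z (F \<inter> I z))"
    using insert.prems insert.hyps by (intro expec_split) auto
  finally show ?case using insert by simp
qed

section \<open>Union bounds, Markov's inequality and exponential tail bounds\<close>

lemma prob_mono:
  assumes "0 \<le> p" "p \<le> 1" "\<And>E. E \<subseteq> I \<Longrightarrow> Q E \<Longrightarrow> R E"
  shows "prob p I Q \<le> prob p I R"
  unfolding prob_def using assms by (intro expec_mono) auto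

lemma prob_markov:
  assumes "0 \<le> p" "p \<le> 1" "\<And>E. E \<subseteq> I \<Longrightarrow> 0 \<le> f E" "\<And>E. E \<subseteq> I \<Longrightarrow> Q E \<Longrightarrow> 1 \<le> f E"
  shows "prob p I Q \<le> expec p I f"
  unfolding prob_def using assms by (intro expec_mono) auto

lemma prob_Bex_le:
  assumes "0 \<le> p" "p \<le> 1" "finite A"
  shows "prob p I (\<lambda>E. \<exists>i\<in>A. Q i E) \<le> (\<Sum>i\<in>A. prob p I (Q i))"
proof -
  have "of_bool (\<exists>i\<in>A. Q i E) \<le> (\<Sum>i\<in>A. of_bool (Q i E) :: real)" for E
  proof (cases "\<exists>i\<in>A. Q i E")
    case True
    then obtain i where "i \<in> A" "Q i E" by auto
    then show ?thesis
      using member_le_sum[of i A "\<lambda>i. of_bool (Q i E) :: real"] assms by auto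
  qed (simp add: sum_nonneg)
  then show ?thesis
    unfolding prob_def using assms by (subst expec_sum[symmetric]) (intro expec_mono)
qed

lemma prob_Bex_const:
  assumes "0 \<le> p" "p \<le> 1" "finite A" "\<And>i. i \<in> A \<Longrightarrow> prob p I (Q i) \<le> c"
  shows "prob p I (\<lambda>E. \<exists>i\<in>A. Q i E) \<le> real (card A) * c"
  using prob_Bex_le[OF assms(1-3), of I Q] sum_bounded_above[of A "\<lambda>i. prob p I (Q i)" c] assms(4)
  by (meson order_trans)

lemma prob_disj_le:
  assumes "0 \<le> p" "p \<le> 1"
  shows "prob p I (\<lambda>E. Q E \<or> R E) \<le> prob p I Q + prob p I R"
  unfolding prob_def expec_add[symmetric] using assms by (intro expec_mono) auto

text \<open>The indicator is a product over \<open>E\<close> times a product over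
  \<open>I - E\<close>, so \<open>expec_prod\<close> applies. By disjointness each resulting factor
  is \<open>p\<close> on \<open>J\<close>, \<open>1 - p\<close> on \<open>K\<close> and 1
  elsewhere.\<close>

lemma prob_contains_avoids:
  assumes "finite I" "J \<subseteq> I" "K \<subseteq> I" "J \<inter> K = {}"
  shows "prob p I (\<lambda>E. J \<subseteq> E \<and> E \<inter> K = {}) = p ^ card J * (1 - p) ^ card K"
proof -
  have fin: "finite J" "finite K" using assms by (auto intro: finite_subset)
  have "prob p I (\<lambda>E. J \<subseteq> E \<and> E \<inter> K = {})
    = expec p I (\<lambda>E. (\<Prod>e\<in>E. of_bool (e \<notin> K)) * (\<Prod>e\<in>I - E. of_bool (e \<notin> J)))"
    unfolding prob_def
  proof (rule expec_cong)
    fix E assume E: "E \<subseteq> I"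
    then have "finite E" using assms(1) by (rule finite_subset)
    then have "(\<Prod>e\<in>E. of_bool (e \<notin> K)) = (of_bool (E \<inter> K = {}) :: real)"
      by (auto simp: prod_zero_iff intro!: prod.neutral)
    moreover have "(\<Prod>e\<in>I - E. of_bool (e \<notin> J)) = (of_bool (J \<subseteq> E) :: real)"
      using assms E by (auto simp: prod_zero_iff intro!: prod.neutral)
    ultimately show "of_bool (J \<subseteq> E \<and> E \<inter> K = {})
      = (\<Prod>e\<in>E. of_bool (e \<notin> K)) * (\<Prod>e\<in>I - E. of_bool (e \<notin> J) :: real)" by auto
  qed
  also have "\<dots> = (\<Prod>e\<in>I. p * of_bool (e \<notin> K) + (1 - p) * of_bool (e \<notin> J))"
    by (rule expec_prod) fact
  also have "\<dots> = (\<Prod>e\<in>I. (if e \<in> J then p else 1) * (if e \<in> K then 1 - p else 1))"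
    using assms by (intro prod.cong) auto
  also have "\<dots> = p ^ card J * (1 - p) ^ card K"
    using assms fin by (simp add: prod.distrib prod.If_cases Int_absorb1 flip: prod.inter_restrict)
  finally show ?thesis .
qed

lemma prob_contains:
  assumes "finite I" "J \<subseteq> I"
  shows "prob p I (\<lambda>E. J \<subseteq> E) = p ^ card J"
  using prob_contains_avoids[OF assms, of "{}" p] by simp

text \<open>The expectation factorises, and \<open>1 + x \<le> exp x\<close> bounds each factor. The
  sign of \<theta> is free, so the same bound serves the upper and the lower tail.\<close>

lemma expec_exp_card:
  fixes p \<theta> :: real
  assumes "0 \<le> p" "p \<le> 1" "finite I" "J \<subseteq> I"
  shows "expec p I (\<lambda>E. exp (\<theta> * card (E \<inter> J))) \<le> exp (p * card J * (exp \<theta> - 1))"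
proof -
  have "expec p I (\<lambda>E. exp (\<theta> * card (E \<inter> J))) = expec p J (\<lambda>E. exp (\<theta> * card E))"
    by (rule expec_restrict[OF assms(3,4), of p "\<lambda>E. exp (\<theta> * card E)"])
  also have "\<dots> = expec p J (\<lambda>E. \<Prod>e\<in>E. exp \<theta>)"
    by (simp flip: exp_of_nat_mult add: mult.commute)
  also have "\<dots> = (\<Prod>e\<in>J. p * exp \<theta> + (1 - p))"
    using assms finite_subset by (intro expec_prod') auto
  also have "\<dots> \<le> (\<Prod>e\<in>J. exp (p * (exp \<theta> - 1)))"
  proof (intro prod_mono conjI)
    show "p * exp \<theta> + (1 - p) \<le> exp (p * (exp \<theta> - 1))"
      using exp_ge_add_one_self[of "p * (exp \<theta> - 1)"] by (simp add: algebra_simps)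
  qed (use assms in auto)
  also have "\<dots> = exp (p * card J * (exp \<theta> - 1))"
    by (simp flip: exp_of_nat_mult add: mult_ac)
  finally show ?thesis .
qed

lemma prob_card_ge:
  fixes p \<theta> m :: real
  assumes "0 \<le> p" "p \<le> 1" "finite I" "J \<subseteq> I" "0 \<le> \<theta>"
  shows "prob p I (\<lambda>E. m \<le> card (E \<inter> J)) \<le> exp (p * card J * (exp \<theta> - 1) - \<theta> * m)"
proof -
  have "prob p I (\<lambda>E. m \<le> card (E \<inter> J)) \<le> expec p I (\<lambda>E. exp (- (\<theta> * m)) * exp (\<theta> * card (E \<inter> J)))"
    using assms by (intro prob_markov) (auto simp flip: exp_add intro!: mult_left_mono)
  also have "\<dots> \<le> exp (- (\<theta> * m)) * exp (p * card J * (exp \<theta> - 1))"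
    unfolding expec_cmult using assms by (intro mult_left_mono expec_exp_card) auto
  finally show ?thesis by (simp flip: exp_add)
qed

lemma prob_card_le:
  fixes p \<theta> m :: real
  assumes "0 \<le> p" "p \<le> 1" "finite I" "J \<subseteq> I" "0 \<le> \<theta>"
  shows "prob p I (\<lambda>E. card (E \<inter> J) \<le> m) \<le> exp (\<theta> * m - p * card J * (1 - exp (- \<theta>)))"
proof -
  have "prob p I (\<lambda>E. card (E \<inter> J) \<le> m) \<le> expec p I (\<lambda>E. exp (\<theta> * m) * exp (- \<theta> * card (E \<inter> J)))"
    using assms by (intro prob_markov) (auto simp flip: exp_add intro!: mult_left_mono)
  also have "\<dots> \<le> exp (\<theta> * m) * exp (p * card J * (exp (- \<theta>) - 1))"
    unfolding expec_cmult using assms by (intro mult_left_mono expec_exp_card) auto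
  finally show ?thesis by (simp flip: exp_add add: algebra_simps)
qed

lemma prob_less_1_obtains:
  assumes "finite I" "0 \<le> p" "p \<le> 1" "prob p I Q < 1"
  obtains E where "E \<subseteq> I" "\<not> Q E"
proof -
  have "\<not> (\<forall>E. E \<subseteq> I \<longrightarrow> Q E)"
  proof
    assume "\<forall>E. E \<subseteq> I \<longrightarrow> Q E"
    then have "prob p I Q = expec p I (\<lambda>_. 1)" unfolding prob_def by (intro expec_cong) auto
    with assms show False by (simp add: expec_const)
  qed
  with that show ?thesis by blast
qed

lemma choose_le: "real (n choose j) \<le> (exp 1 * n / j) ^ j"
proof (cases "j = 0")
  case False
  have "real (n choose j) \<le> real n ^ j / fact j"
    using binomial_fact_pow[of n j] by (simp add: field_simps) (metis of_nat_fact of_nat_le_iff of_nat_mult of_nat_power)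
  also have "\<dots> \<le> (exp 1 * n / j) ^ j"
  proof -
    \<comment> \<open>\<open>j ^ j / fact j\<close> is a single term of the series of
      \<open>exp j\<close>.\<close>
    have "(\<Sum>n\<in>{j}. real j ^ n /\<^sub>R fact n) \<le> exp (real j)"
      unfolding exp_def by (intro sum_le_suminf summable_exp_generic) auto
    then have "real j ^ j \<le> fact j * exp 1 ^ j" by (simp add: field_simps flip: exp_of_nat_mult)
    then have "real j ^ j * real n ^ j \<le> fact j * exp 1 ^ j * real n ^ j" by (rule mult_right_mono) simp
    then show ?thesis using False by (simp add: field_simps power_mult_distrib)
  qed
  finally show ?thesis .
qed simp

text \<open>Chernoff bound with \<theta> = 1/20: since \<open>exp (1/20) - 1\<close> is at most
  21/400, the exponent is at most \<open>p * N * (21/400 - 22/400)\<close>.\<close>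

lemma prob_card_ge_mean:
  fixes p :: real
  assumes "0 \<le> p" "p \<le> 1" "finite I" "J \<subseteq> I" "card J \<le> N"
  shows "prob p I (\<lambda>E. 11 / 10 * (p * N) \<le> card (E \<inter> J)) \<le> exp (- (p * N / 400))"
proof -
  have "prob p I (\<lambda>E. 11 / 10 * (p * N) \<le> card (E \<inter> J))
    \<le> exp (p * card J * (exp (1 / 20) - 1) - 1 / 20 * (11 / 10 * (p * N)))"
    using assms by (intro prob_card_ge) auto
  also have "\<dots> \<le> exp (- (p * N / 400))"
  proof -
    have "exp (1 / 20) - 1 \<le> (21 / 400 :: real)"
      using exp_bound[of "1 / 20"] by (simp add: power2_eq_square)
    then have "p * card J * (exp (1 / 20) - 1) \<le> p * N * (21 / 400)"
      using assms by (intro mult_mono) auto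
    then show ?thesis by simp
  qed
  finally show ?thesis .
qed

section \<open>Edge-disjoint triangles\<close>

text \<open>Maximality is kept separate: the probability estimate rests on edge-disjointness,
  whereas triangle-freeness of the remainder rests on maximality.\<close>

definition edge_packing :: "'a set set \<Rightarrow> 'a set set \<Rightarrow> bool" where
  "edge_packing G T \<longleftrightarrow> (\<forall>\<tau>\<in>T. card \<tau> = 3 \<and> [\<tau>]\<^bsup>2\<^esup> \<subseteq> G) \<and>
     pairwise (\<lambda>\<sigma> \<tau>. [\<sigma>]\<^bsup>2\<^esup> \<inter> [\<tau>]\<^bsup>2\<^esup> = {}) T"

abbreviation edges_of :: "'a set set \<Rightarrow> 'a set set" where
  "edges_of T \<equiv> (\<Union>\<tau>\<in>T. [\<tau>]\<^bsup>2\<^esup>)"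

lemma card_nsets_2_of_3: "card \<tau> = 3 \<Longrightarrow> card ([\<tau>]\<^bsup>2\<^esup>) = 3"
  by (simp add: choose_two)

lemma triangle_subset:
  assumes "card \<tau> = 3" "[\<tau>]\<^bsup>2\<^esup> \<subseteq> G" "G \<subseteq> [Y]\<^bsup>2\<^esup>"
  shows "\<tau> \<subseteq> Y"
proof -
  obtain x y z where \<tau>: "\<tau> = {x, y, z}" "x \<noteq> y" "x \<noteq> z" "y \<noteq> z"
    using assms(1) by (auto simp: card_3_iff)
  then have "{x, y} \<in> [\<tau>]\<^bsup>2\<^esup>" "{x, z} \<in> [\<tau>]\<^bsup>2\<^esup>" by simp_all
  then have "{x, y} \<in> [Y]\<^bsup>2\<^esup>" "{x, z} \<in> [Y]\<^bsup>2\<^esup>" using assms(2,3) by blast+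
  then show ?thesis unfolding \<tau> by simp
qed

lemma edge_packing_maximal:
  assumes "G \<subseteq> [Y]\<^bsup>2\<^esup>" "finite Y"
  shows "\<exists>T. edge_packing G T \<and>
    (\<forall>\<tau>. card \<tau> = 3 \<longrightarrow> [\<tau>]\<^bsup>2\<^esup> \<subseteq> G \<longrightarrow> [\<tau>]\<^bsup>2\<^esup> \<inter> edges_of T \<noteq> {})"
proof -
  let ?P = "{T. edge_packing G T}"
  have "?P \<subseteq> Pow (Pow Y)" unfolding edge_packing_def using triangle_subset[OF _ _ assms(1)] by blast
  then have "finite ?P" using assms(2) by (meson finite_Pow_iff finite_subset)
  moreover have "{} \<in> ?P" by (simp add: edge_packing_def)
  ultimately obtain T where T: "T \<in> ?P" "\<And>U. U \<in> ?P \<Longrightarrow> T \<subseteq> U \<Longrightarrow> T = U"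
    using finite_has_maximal[of ?P] by blast
  show ?thesis
  proof (intro exI conjI allI impI)
    show "edge_packing G T" using T by simp
    fix \<tau> :: "'a set" assume \<tau>: "card \<tau> = 3" "[\<tau>]\<^bsup>2\<^esup> \<subseteq> G"
    show "[\<tau>]\<^bsup>2\<^esup> \<inter> edges_of T \<noteq> {}"
    proof
      assume dis: "[\<tau>]\<^bsup>2\<^esup> \<inter> edges_of T = {}"
      then have "edge_packing G (insert \<tau> T)"
        using T(1) \<tau> unfolding edge_packing_def pairwise_insert by blast
      then have "insert \<tau> T \<in> ?P" by simp
      \<comment> \<open>By maximality \<open>\<tau>\<close> would belong to \<open>T\<close>, so its
        edges would be among those it avoids; it would have no edges, yet it has three.\<close>
      then have "T = insert \<tau> T" using T(2) by blast
      then have "\<tau> \<in> T" by blast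
      with dis have "[\<tau>]\<^bsup>2\<^esup> = {}" by blast
      then have "card ([\<tau>]\<^bsup>2\<^esup>) = 0" by simp
      with card_nsets_2_of_3[OF \<tau>(1)] show False by linarith
    qed
  qed
qed

lemma card_edges_of:
  assumes "edge_packing G T" "finite T"
  shows "card (edges_of T) = 3 * card T"
proof -
  have "card (edges_of T) = (\<Sum>\<tau>\<in>T. card ([\<tau>]\<^bsup>2\<^esup>))"
  proof (rule card_UN_disjoint)
    show "\<forall>\<tau>\<in>T. finite ([\<tau>]\<^bsup>2\<^esup>)"
      using assms card_nsets_2_of_3 by (metis edge_packing_def card.infinite zero_neq_numeral)
  qed (use assms in \<open>auto simp: edge_packing_def pairwise_def\<close>)
  then show ?thesis using assms(1) by (simp add: edge_packing_def choose_two)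
qed

lemma sum_Pow_power_card:
  fixes r :: "'b::comm_semiring_1"
  assumes "finite X"
  shows "(\<Sum>T\<in>Pow X. r ^ card T) = (r + 1) ^ card X"
  using prod_add[OF assms, of "\<lambda>_. r" "\<lambda>_. 1"] by simp

text \<open>Triangles of a packing are edge-disjoint, so \<open>t\<close> given ones are present with probability
  \<open>p ^ (3 t)\<close> and cover at most \<open>3t\<close> edges of \<open>F\<close>, while the rest of \<open>F\<close> has to be absent. The union bound
  over all sets of triangles meeting \<open>F\<close> is then a binomial sum.\<close>

lemma prob_edge_packing_covers:
  fixes p :: real
  assumes p: "0 \<le> p" "p < 1" and Y: "finite Y" and F: "F \<subseteq> [Y]\<^bsup>2\<^esup>"
    and T: "\<And>G. G \<subseteq> [Y]\<^bsup>2\<^esup> \<Longrightarrow> edge_packing G (T G)"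
  shows "prob p ([Y]\<^bsup>2\<^esup>) (\<lambda>G. F \<inter> G \<subseteq> edges_of (T G))
    \<le> (1 - p) ^ card F * exp (card F * card Y * (p / (1 - p)) ^ 3)"
proof -
  define X where "X = {\<tau> \<in> [Y]\<^bsup>3\<^esup>. [\<tau>]\<^bsup>2\<^esup> \<inter> F \<noteq> {}}"
  define PP where "PP = {T \<in> Pow X. edge_packing ([Y]\<^bsup>2\<^esup>) T}"
  define r where "r = (p / (1 - p)) ^ 3"
  have fI: "finite ([Y]\<^bsup>2\<^esup>)" using Y by (rule finite_imp_finite_nsets)
  have fF: "finite F" using F fI by (rule finite_subset)
  have fX: "finite X" unfolding X_def using Y by (simp add: finite_imp_finite_nsets)
  have r0: "0 \<le> r" using p by (simp add: r_def)
  \<comment> \<open>A triangle meeting \<open>F\<close> is an edge of \<open>F\<close> together with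
    a third vertex, so there are at most \<open>card F * card Y\<close> of them.\<close>
  have "X \<subseteq> (\<lambda>(e, z). insert z e) ` (F \<times> Y)"
  proof
    fix \<tau> assume "\<tau> \<in> X"
    then obtain e where e: "e \<in> F" "e \<subseteq> \<tau>" "card e = 2" and \<tau>: "\<tau> \<subseteq> Y" "card \<tau> = 3" "finite \<tau>"
      by (auto simp: X_def nsets_def)
    then have "finite e" by (auto intro: finite_subset)
    then have "card (\<tau> - e) = 1" using e \<tau> by (simp add: card_Diff_subset)
    then obtain z where "\<tau> - e = {z}" by (auto simp: card_1_singleton_iff)
    then show "\<tau> \<in> (\<lambda>(e, z). insert z e) ` (F \<times> Y)"
      using e \<tau> by (intro image_eqI[of _ _ "(e, z)"]) auto
  qed
  then have "card X \<le> card (F \<times> Y)" using fF Y by (meson card_image_le card_mono finite_SigmaI finite_imageI le_trans)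
  then have cX: "card X \<le> card F * card Y" by (simp add: card_cartesian_product)
  have "prob p ([Y]\<^bsup>2\<^esup>) (\<lambda>G. F \<inter> G \<subseteq> edges_of (T G))
    \<le> prob p ([Y]\<^bsup>2\<^esup>) (\<lambda>G. \<exists>U\<in>PP. edges_of U \<subseteq> G \<and> G \<inter> (F - edges_of U) = {})"
  proof (rule prob_mono)
    fix G assume G: "G \<subseteq> [Y]\<^bsup>2\<^esup>" and cov: "F \<inter> G \<subseteq> edges_of (T G)"
    \<comment> \<open>Only packing triangles that meet \<open>F\<close> can cover edges of
      \<open>F\<close>; restricting to them keeps the number of candidates proportional to
      \<open>card F\<close>.\<close>
    let ?U = "{\<tau> \<in> T G. [\<tau>]\<^bsup>2\<^esup> \<inter> F \<noteq> {}}"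
    have pk: "edge_packing G (T G)" using T G by blast
    have "\<tau> \<subseteq> Y" if "\<tau> \<in> T G" for \<tau>
      using that pk G triangle_subset[of \<tau> G Y] by (simp add: edge_packing_def)
    then have "?U \<subseteq> X"
      using pk unfolding X_def edge_packing_def nsets_def[of _ 3] by (auto intro: card_ge_0_finite)
    moreover have "edge_packing ([Y]\<^bsup>2\<^esup>) ?U"
      using pk G unfolding edge_packing_def by (blast intro: pairwise_subset[of _ "T G"])
    moreover have "edges_of ?U \<subseteq> G" using pk by (auto simp: edge_packing_def)
    moreover have "G \<inter> (F - edges_of ?U) = {}" using cov by blast
    ultimately show "\<exists>U\<in>PP. edges_of U \<subseteq> G \<and> G \<inter> (F - edges_of U) = {}"
      unfolding PP_def by blast
  qed (use p in auto)
  also have "\<dots> \<le> (\<Sum>U\<in>PP. prob p ([Y]\<^bsup>2\<^esup>) (\<lambda>G. edges_of U \<subseteq> G \<and> G \<inter> (F - edges_of U) = {}))"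
    using p fX by (intro prob_Bex_le) (auto simp: PP_def)
  also have "\<dots> \<le> (\<Sum>U\<in>PP. (1 - p) ^ card F * r ^ card U)"
  proof (rule sum_mono)
    fix U assume "U \<in> PP"
    then have U: "edge_packing ([Y]\<^bsup>2\<^esup>) U" "finite U"
      using fX by (auto simp: PP_def intro: finite_subset)
    have sub: "edges_of U \<subseteq> [Y]\<^bsup>2\<^esup>" using U by (auto simp: edge_packing_def)
    then have fU: "finite (edges_of U)" using fI by (rule finite_subset)
    \<comment> \<open>Each triangle of \<open>U\<close> excuses at most three edges of
      \<open>F\<close> from being absent. Restoring the full factor \<open>(1 - p) ^ card F\<close>
      therefore costs a factor \<open>r\<close> per triangle.\<close>
    have "card F \<le> 3 * card U + card (F - edges_of U)"
      using diff_card_le_card_Diff[OF fU, of F] card_edges_of[OF U] by simp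
    then have "(1 - p) ^ (3 * card U) * (1 - p) ^ card (F - edges_of U) \<le> (1 - p) ^ card F"
      using p by (simp flip: power_add add: power_decreasing)
    then have *: "(1 - p) ^ card (F - edges_of U) \<le> (1 - p) ^ card F / (1 - p) ^ (3 * card U)"
      using p by (simp add: field_simps)
    have "prob p ([Y]\<^bsup>2\<^esup>) (\<lambda>G. edges_of U \<subseteq> G \<and> G \<inter> (F - edges_of U) = {})
      = p ^ (3 * card U) * (1 - p) ^ card (F - edges_of U)"
      using sub F fI by (subst prob_contains_avoids) (auto simp: card_edges_of[OF U])
    also have "\<dots> \<le> p ^ (3 * card U) * ((1 - p) ^ card F / (1 - p) ^ (3 * card U))"
      using p * by (intro mult_left_mono) auto
    also have "\<dots> = (1 - p) ^ card F * r ^ card U"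
      by (simp add: r_def power_divide flip: power_mult)
    finally show "prob p ([Y]\<^bsup>2\<^esup>) (\<lambda>G. edges_of U \<subseteq> G \<and> G \<inter> (F - edges_of U) = {})
      \<le> (1 - p) ^ card F * r ^ card U" .
  qed
  \<comment> \<open>Passing from packings to all subsets of \<open>X\<close> adds only nonnegative
    terms and leaves a binomial sum.\<close>
  also have "\<dots> \<le> (\<Sum>U\<in>Pow X. (1 - p) ^ card F * r ^ card U)"
    using fX p r0 by (intro sum_mono2) (auto simp: PP_def)
  also have "\<dots> = (1 - p) ^ card F * (r + 1) ^ card X"
    using sum_Pow_power_card[OF fX, of r] by (simp flip: sum_distrib_left)
  also have "\<dots> \<le> (1 - p) ^ card F * exp (card F * card Y * r)"
  proof (rule mult_left_mono)
    have "(r + 1) ^ card X \<le> exp r ^ card X"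
      using exp_ge_add_one_self[of r] r0 by (intro power_mono) (auto simp: add.commute)
    also have "\<dots> = exp (card X * r)" by (simp add: exp_of_nat_mult)
    also have "\<dots> \<le> exp (card F * card Y * r)"
      using cX r0 by (auto intro!: mult_right_mono simp flip: of_nat_mult)
    finally show "(r + 1) ^ card X \<le> exp (card F * card Y * r)" .
  qed (use p in auto)
  finally show ?thesis by (simp add: r_def)
qed

text \<open>Pairs are ordered, which costs a factor 2 when they are turned into edges. The condition
  \<open>y v \<noteq> y v'\<close> forces distinct points, so an open pair gives a genuine edge once
  the other coordinate is injective.\<close>

definition open_pairs :: "'b set set \<Rightarrow> ('a \<Rightarrow> 'b) \<Rightarrow> 'a set \<Rightarrow> ('a \<times> 'a) set" where
  "open_pairs G y S = {(v, v'). v \<in> S \<and> v' \<in> S \<and> y v \<noteq> y v' \<and> \<not> (\<exists>z. {z, y v} \<in> G \<and> {z, y v'} \<in> G)}"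

lemma card_pairs_le:
  assumes "finite P"
  shows "card P \<le> 2 * card ((\<lambda>(u, v). {u, v}) ` P)"
proof -
  let ?f = "\<lambda>(u, v). {u, v}"
  have "card P = (\<Sum>e\<in>?f ` P. card {x \<in> P. ?f x = e})"
    using sum.image_gen[OF assms, of "\<lambda>_. 1 :: nat" ?f] by simp
  also have "\<dots> \<le> (\<Sum>e\<in>?f ` P. 2)"
  proof (rule sum_mono)
    fix e assume "e \<in> ?f ` P"
    then obtain u v where e: "e = {u, v}" by (metis (no_types, lifting) imageE case_prod_beta)
    have "{x \<in> P. ?f x = e} \<subseteq> {(u, v), (v, u)}"
    proof
      fix x assume "x \<in> {x \<in> P. ?f x = e}"
      then show "x \<in> {(u, v), (v, u)}" by (cases x) (simp add: e doubleton_eq_iff)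
    qed
    then have "card {x \<in> P. ?f x = e} \<le> card {(u, v), (v, u)}" by (rule card_mono[rotated]) simp
    also have "\<dots> \<le> 2" using card_length[of "[(u, v), (v, u)]"] by simp
    finally show "card {x \<in> P. ?f x = e} \<le> 2" .
  qed
  finally show ?thesis by (simp add: mult.commute)
qed

section \<open>Counting open pairs\<close>

definition hits :: "'b set set \<Rightarrow> ('a \<Rightarrow> 'b) \<Rightarrow> 'a set \<Rightarrow> 'b \<Rightarrow> 'a set" where
  "hits G y S z = {v \<in> S. {z, y v} \<in> G}"

definition closed_via :: "'b set set \<Rightarrow> ('a \<Rightarrow> 'b) \<Rightarrow> 'a set \<Rightarrow> 'b \<Rightarrow> ('a \<times> 'a) set" where
  "closed_via G y S z = {(v, v'). v \<in> hits G y S z \<and> v' \<in> hits G y S z \<and> y v \<noteq> y v'}"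

lemma finite_hits [intro]: "finite S \<Longrightarrow> finite (hits G y S z)"
  by (simp add: hits_def)

lemma closed_via_subset: "closed_via G y S z \<subseteq> hits G y S z \<times> hits G y S z"
  by (auto simp: closed_via_def)

lemma card_closed_via_le:
  assumes "finite S"
  shows "real (card (closed_via G y S z)) \<le> (real (card (hits G y S z)))\<^sup>2"
proof -
  have "card (closed_via G y S z) \<le> card (hits G y S z \<times> hits G y S z)"
    using assms by (intro card_mono closed_via_subset) auto
  then show ?thesis
    by (simp add: card_cartesian_product power2_eq_square flip: of_nat_mult)
qed

lemma finite_closed_via [intro]: "finite S \<Longrightarrow> finite (closed_via G y S z)"
  using closed_via_subset finite_hits by (metis finite_SigmaI finite_subset)

lemma card_preimage_le:
  fixes \<beta> :: real
  assumes "finite S" "finite N" "\<And>u. card {v \<in> S. y v = u} \<le> \<beta>"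
  shows "card {v \<in> S. y v \<in> N} \<le> \<beta> * card N"
proof -
  have "{v \<in> S. y v \<in> N} = (\<Union>u\<in>N. {v \<in> S. y v = u})" by auto
  then have "card {v \<in> S. y v \<in> N} \<le> (\<Sum>u\<in>N. card {v \<in> S. y v = u})"
    using card_UN_le[OF assms(2), of "\<lambda>u. {v \<in> S. y v = u}"] by simp
  then have "real (card {v \<in> S. y v \<in> N}) \<le> (\<Sum>u\<in>N. real (card {v \<in> S. y v = u}))"
    by (simp flip: of_nat_sum)
  also have "\<dots> \<le> \<beta> * card N"
    using sum_bounded_above[of N "\<lambda>u. real (card {v \<in> S. y v = u})" \<beta>] assms(3) by (simp add: mult.commute)
  finally show ?thesis .
qed

text \<open>If the sets \<open>W z\<close> are large but meet pairwise in few points, then they are nearly disjoint: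
  Cauchy--Schwarz for the function counting how many of them contain a given point.\<close>

lemma sum_card_large_sets_le:
  fixes T c :: real
  assumes "finite S" "finite H" "\<And>z. z \<in> H \<Longrightarrow> W z \<subseteq> S" "\<And>z. z \<in> H \<Longrightarrow> T \<le> card (W z)"
    and c: "\<And>z z'. z \<in> H \<Longrightarrow> z' \<in> H \<Longrightarrow> z \<noteq> z' \<Longrightarrow> card (W z \<inter> W z') \<le> c"
    and T: "0 < T" "0 \<le> c" "10 * card S * c \<le> T\<^sup>2"
  shows "(\<Sum>z\<in>H. real (card (W z))) \<le> 10 / 9 * card S"
proof -
  define \<Omega> where "\<Omega> = (\<Sum>z\<in>H. real (card (W z)))"
  define m where "m v = (\<Sum>z\<in>H. of_bool (v \<in> W z) :: real)" for v
  have \<Omega>0: "0 \<le> \<Omega>" by (simp add: \<Omega>_def sum_nonneg)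
  have cardW: "(\<Sum>v\<in>S. of_bool (v \<in> A)) = real (card A)" if "A \<subseteq> S" for A
    using that assms(1) by (simp add: of_bool_def sum.If_cases Int_absorb1 Collect_mem_eq)
  have "(\<Sum>v\<in>S. m v) = \<Omega>"
    unfolding m_def \<Omega>_def by (subst sum.swap) (intro sum.cong refl cardW assms(3))
  then have "\<Omega>\<^sup>2 \<le> (\<Sum>v\<in>S. (m v)\<^sup>2) * card S"
    using sum_squared_le_sum_of_squares[of m S] by simp
  \<comment> \<open>The square of \<open>m v\<close> counts ordered pairs of sets through
    \<open>v\<close>; double counting turns the sum into pairwise intersections.\<close>
  also have "(\<Sum>v\<in>S. (m v)\<^sup>2) = (\<Sum>z\<in>H. \<Sum>z'\<in>H. real (card (W z \<inter> W z')))"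
  proof -
    have "(m v)\<^sup>2 = (\<Sum>z\<in>H. \<Sum>z'\<in>H. of_bool (v \<in> W z \<inter> W z'))" for v
      unfolding m_def power2_eq_square sum_product by (intro sum.cong refl) auto
    then have "(\<Sum>v\<in>S. (m v)\<^sup>2) = (\<Sum>z\<in>H. \<Sum>v\<in>S. \<Sum>z'\<in>H. of_bool (v \<in> W z \<inter> W z'))"
      by (simp only: ) (rule sum.swap)
    also have "\<dots> = (\<Sum>z\<in>H. \<Sum>z'\<in>H. \<Sum>v\<in>S. of_bool (v \<in> W z \<inter> W z'))"
      by (intro sum.cong refl sum.swap)
    also have "\<dots> = (\<Sum>z\<in>H. \<Sum>z'\<in>H. real (card (W z \<inter> W z')))"
      using assms(3) by (intro sum.cong refl cardW) auto
    finally show ?thesis .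
  qed
  also have "\<dots> \<le> (\<Sum>z\<in>H. \<Sum>z'\<in>H. (if z = z' then real (card (W z)) else 0) + c)"
    using c T(2) by (intro sum_mono) auto
  also have "\<dots> = \<Omega> + (real (card H))\<^sup>2 * c"
    using assms(2) by (simp add: sum.distrib \<Omega>_def power2_eq_square)
  finally have 1: "\<Omega>\<^sup>2 \<le> (\<Omega> + (real (card H))\<^sup>2 * c) * card S"
    by (simp add: mult_right_mono)
  have "T * card H \<le> \<Omega>"
    using sum_bounded_below[of H T "\<lambda>z. real (card (W z))"] assms(4) by (simp add: \<Omega>_def mult.commute)
  then have "(T * card H)\<^sup>2 \<le> \<Omega>\<^sup>2" using T by (intro power_mono) auto
  then have "10 * card S * c * (real (card H))\<^sup>2 \<le> \<Omega>\<^sup>2"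
    using mult_right_mono[OF T(3), of "(real (card H))\<^sup>2"] by (simp add: power_mult_distrib)
  \<comment> \<open>The lower bound on \<open>T\<close> absorbs the off-diagonal intersections into
    a tenth of the left side; hence the factor 10/9.\<close>
  then have "\<Omega>\<^sup>2 \<le> \<Omega> * card S + \<Omega>\<^sup>2 / 10" using 1 by (simp add: algebra_simps)
  then have "\<Omega> * (9 / 10 * \<Omega>) \<le> \<Omega> * card S" by (simp add: power2_eq_square)
  then show ?thesis
    using \<Omega>0 by (cases "\<Omega> = 0") (auto simp: \<Omega>_def[symmetric])
qed

lemma edge_ends:
  assumes "{z, u} \<in> G" "G \<subseteq> [Y]\<^bsup>2\<^esup>"
  shows "z \<in> Y" "u \<in> Y" "z \<noteq> u"
proof -
  have "{z, u} \<in> [Y]\<^bsup>2\<^esup>" using assms by blast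
  then show "z \<in> Y" "u \<in> Y" "z \<noteq> u" by simp_all
qed

text \<open>Handshake count: an edge inside \<open>B\<close> is seen from at most its two
  ends.\<close>

lemma sum_card_nbrs_le:
  assumes "finite B" "G \<subseteq> [Y]\<^bsup>2\<^esup>"
  shows "(\<Sum>z\<in>B. card {u \<in> B. {z, u} \<in> G}) \<le> 2 * card (G \<inter> [B]\<^bsup>2\<^esup>)"
proof -
  let ?P = "SIGMA z:B. {u \<in> B. {z, u} \<in> G}"
  have fin: "finite ?P" using assms by auto
  have "(\<lambda>(u, v). {u, v}) ` ?P \<subseteq> G \<inter> [B]\<^bsup>2\<^esup>"
    using edge_ends[OF _ assms(2)] by auto
  then have "card ((\<lambda>(u, v). {u, v}) ` ?P) \<le> card (G \<inter> [B]\<^bsup>2\<^esup>)"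
    using assms(1) by (intro card_mono) (auto intro: finite_imp_finite_nsets)
  moreover have "(\<Sum>z\<in>B. card {u \<in> B. {z, u} \<in> G}) = card ?P"
    using assms by (subst card_SigmaI) auto
  ultimately show ?thesis using card_pairs_le[OF fin] by linarith
qed

text \<open>The truncation at \<open>T\<close> keeps exponential moments bounded. Vertices with more
  than \<open>T\<close> hits are treated by near-disjointness instead.\<close>

definition light_closed :: "real \<Rightarrow> 'b set set \<Rightarrow> ('a \<Rightarrow> 'b) \<Rightarrow> 'a set \<Rightarrow> 'b \<Rightarrow> real" where
  "light_closed T G y S z = (if real (card (hits G y S z)) \<le> T then real (card (closed_via G y S z)) else 0)"

text \<open>A pair that is not open has equal images or is closed via some \<open>z\<close>. These
  \<open>z\<close> are split into heavy ones, light ones in the image of \<open>S\<close>, and light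
  ones outside. The last two are separated because only for \<open>z\<close> outside the image do
  different \<open>z\<close> involve disjoint sets of potential edges, which later gives
  independence.\<close>

lemma card_open_pairs_ge:
  fixes \<beta> D c M T \<delta> :: real
  assumes "finite Y" "finite S" "y ` S \<subseteq> Y" "G \<subseteq> [Y]\<^bsup>2\<^esup>"
    and fib: "\<And>u. card {v \<in> S. y v = u} \<le> \<beta>"
    and deg: "\<And>z. z \<in> Y \<Longrightarrow> card {u \<in> Y. {z, u} \<in> G} \<le> D"
    and codeg: "\<And>z z'. z \<in> Y \<Longrightarrow> z' \<in> Y \<Longrightarrow> z \<noteq> z' \<Longrightarrow> card {u \<in> Y. {z, u} \<in> G \<and> {z', u} \<in> G} \<le> c"
    and T: "0 < T" "0 \<le> c" "0 \<le> D" "10 * card S * (\<beta> * c) \<le> T\<^sup>2"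
    and sparse: "card (G \<inter> [y ` S]\<^bsup>2\<^esup>) \<le> M"
    and light: "(\<Sum>z\<in>Y - y ` S. light_closed T G y S z) \<le> \<delta> * (real (card S))\<^sup>2"
  shows "(real (card S))\<^sup>2 - \<beta> * card S - 10 / 9 * (\<beta> * D) * card S - 2 * T * \<beta> * M - \<delta> * (real (card S))\<^sup>2
    \<le> card (open_pairs G y S)"
proof -
  let ?w = "\<lambda>z. real (card (hits G y S z))"
  let ?q = "\<lambda>z. real (card (closed_via G y S z))"
  let ?a = "real (card S)"
  have \<beta>0: "0 \<le> \<beta>" using fib by (meson of_nat_0_le_iff order_trans)
  define H where "H = {z \<in> Y. \<not> ?w z \<le> T}"
  let ?same = "{(v, v'). v \<in> S \<and> v' \<in> S \<and> y v = y v'}"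
  have H: "finite H" "H \<subseteq> Y" using assms by (auto simp: H_def)
  have hits_eq: "hits G y S z = {v \<in> S. y v \<in> {u \<in> Y. {z, u} \<in> G}}" for z
    using assms(3) by (auto simp: hits_def)
  have w_le: "?w z \<le> \<beta> * D" if "z \<in> Y" for z
  proof -
    have "?w z \<le> \<beta> * card {u \<in> Y. {z, u} \<in> G}"
      unfolding hits_eq using assms fib by (intro card_preimage_le) auto
    also have "\<dots> \<le> \<beta> * D" using deg[OF that] \<beta>0 by (rule mult_left_mono)
    finally show ?thesis .
  qed
  have heavy: "(\<Sum>z\<in>H. ?w z) \<le> 10 / 9 * ?a"
  proof (rule sum_card_large_sets_le)
    fix z z' assume z: "z \<in> H" "z' \<in> H" "z \<noteq> z'"
    have "hits G y S z \<inter> hits G y S z' = {v \<in> S. y v \<in> {u \<in> Y. {z, u} \<in> G \<and> {z', u} \<in> G}}"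
      using assms(3) by (auto simp: hits_def)
    then have "real (card (hits G y S z \<inter> hits G y S z')) \<le> \<beta> * card {u \<in> Y. {z, u} \<in> G \<and> {z', u} \<in> G}"
      using assms fib card_preimage_le[of S "{u \<in> Y. {z, u} \<in> G \<and> {z', u} \<in> G}" y \<beta>] by simp
    also have "\<dots> \<le> \<beta> * c" using codeg z H \<beta>0 by (intro mult_left_mono) auto
    finally show "real (card (hits G y S z \<inter> hits G y S z')) \<le> \<beta> * c" .
  qed (use assms H \<beta>0 in \<open>auto simp: hits_def H_def\<close>)
  \<comment> \<open>A heavy vertex hits at most \<open>\<beta> * D\<close> points, so squaring the
    hit count costs just this factor over the near-disjointness bound.\<close>
  have "(\<Sum>z\<in>H. ?q z) \<le> (\<Sum>z\<in>H. (\<beta> * D) * ?w z)"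
  proof (rule sum_mono)
    fix z assume "z \<in> H"
    then have "?w z * ?w z \<le> (\<beta> * D) * ?w z" using w_le H by (intro mult_right_mono) auto
    then show "?q z \<le> (\<beta> * D) * ?w z"
      using card_closed_via_le[OF assms(2), of G y z] by (simp add: power2_eq_square)
  qed
  also have "\<dots> \<le> (\<beta> * D) * (10 / 9 * ?a)"
    unfolding sum_distrib_left[symmetric] using heavy \<beta>0 T by (intro mult_left_mono) auto
  finally have q1: "(\<Sum>z\<in>H. ?q z) \<le> 10 / 9 * (\<beta> * D) * ?a" by simp
  \<comment> \<open>For light vertices the square is at most \<open>T\<close> times the hit count,
    and inside the image the hits are controlled by the few edges spanned there.\<close>
  have "(\<Sum>z\<in>y ` S - H. ?q z) \<le> (\<Sum>z\<in>y ` S - H. T * ?w z)"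
  proof (rule sum_mono)
    fix z assume "z \<in> y ` S - H"
    then have "?w z * ?w z \<le> T * ?w z" using assms(3) by (intro mult_right_mono) (auto simp: H_def)
    then show "?q z \<le> T * ?w z"
      using card_closed_via_le[OF assms(2), of G y z] by (simp add: power2_eq_square)
  qed
  also have "\<dots> \<le> (\<Sum>z\<in>y ` S. T * (\<beta> * card {u \<in> y ` S. {z, u} \<in> G}))"
  proof (rule order_trans[OF sum_mono2 sum_mono])
    fix z assume "z \<in> y ` S"
    have "hits G y S z = {v \<in> S. y v \<in> {u \<in> y ` S. {z, u} \<in> G}}" by (auto simp: hits_def)
    then have "?w z \<le> \<beta> * card {u \<in> y ` S. {z, u} \<in> G}"
      using assms fib card_preimage_le[of S "{u \<in> y ` S. {z, u} \<in> G}" y \<beta>] by simp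
    then show "T * ?w z \<le> T * (\<beta> * card {u \<in> y ` S. {z, u} \<in> G})" using T by simp
  qed (use assms T in auto)
  also have "\<dots> = T * \<beta> * (\<Sum>z\<in>y ` S. card {u \<in> y ` S. {z, u} \<in> G})"
    by (simp add: sum_distrib_left mult_ac)
  also have "\<dots> \<le> T * \<beta> * (2 * M)"
  proof (rule mult_left_mono)
    have "real (\<Sum>z\<in>y ` S. card {u \<in> y ` S. {z, u} \<in> G}) \<le> real (2 * card (G \<inter> [y ` S]\<^bsup>2\<^esup>))"
      unfolding of_nat_le_iff using assms by (intro sum_card_nbrs_le) auto
    then show "real (\<Sum>z\<in>y ` S. card {u \<in> y ` S. {z, u} \<in> G}) \<le> 2 * M" using sparse by simp
  qed (use \<beta>0 T in auto)
  finally have q2: "(\<Sum>z\<in>y ` S - H. ?q z) \<le> 2 * T * \<beta> * M" by (simp add: mult_ac)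
  have "(\<Sum>z\<in>Y - y ` S - H. ?q z) \<le> (\<Sum>z\<in>Y - y ` S - H. light_closed T G y S z)"
    by (intro sum_mono) (auto simp: light_closed_def H_def)
  also have "\<dots> \<le> (\<Sum>z\<in>Y - y ` S. light_closed T G y S z)"
    using assms by (intro sum_mono2) (auto simp: light_closed_def)
  finally have q3: "(\<Sum>z\<in>Y - y ` S - H. ?q z) \<le> \<delta> * ?a\<^sup>2" using light by simp
  have "Y = H \<union> (y ` S - H) \<union> (Y - y ` S - H)" using H assms(3) by auto
  then have "(\<Sum>z\<in>Y. ?q z) = (\<Sum>z\<in>H \<union> (y ` S - H) \<union> (Y - y ` S - H). ?q z)" by simp
  also have "\<dots> = (\<Sum>z\<in>H. ?q z) + (\<Sum>z\<in>y ` S - H. ?q z) + (\<Sum>z\<in>Y - y ` S - H. ?q z)"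
  proof -
    have fin: "finite H" "finite (y ` S - H)" "finite (Y - y ` S - H)" using assms H by auto
    have "(H \<union> (y ` S - H)) \<inter> (Y - y ` S - H) = {}" "H \<inter> (y ` S - H) = {}" by auto
    then show ?thesis using fin by (simp only: sum.union_disjoint finite_Un)
  qed
  finally have q: "(\<Sum>z\<in>Y. ?q z) \<le> 10 / 9 * (\<beta> * D) * ?a + 2 * T * \<beta> * M + \<delta> * ?a\<^sup>2"
    using q1 q2 q3 by linarith
  have fin_open: "finite (open_pairs G y S)"
    by (rule finite_subset[of _ "S \<times> S"]) (use assms in \<open>auto simp: open_pairs_def\<close>)
  have fin_same: "finite ?same"
    by (rule finite_subset[of _ "S \<times> S"]) (use assms in auto)
  have same: "real (card ?same) \<le> \<beta> * ?a"
  proof -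
    have "?same = (SIGMA v:S. {v' \<in> S. y v' = y v})" by auto
    then have "real (card ?same) = (\<Sum>v\<in>S. real (card {v' \<in> S. y v' = y v}))"
      using assms by (simp add: card_SigmaI)
    also have "\<dots> \<le> ?a * \<beta>"
      using sum_bounded_above[of S "\<lambda>v. real (card {v' \<in> S. y v' = y v})" \<beta>] fib by simp
    finally show ?thesis by (simp add: mult.commute)
  qed
  have "S \<times> S \<subseteq> ?same \<union> (\<Union>z\<in>Y. closed_via G y S z) \<union> open_pairs G y S"
  proof
    fix x assume "x \<in> S \<times> S"
    then obtain v v' where x: "x = (v, v')" "v \<in> S" "v' \<in> S" by auto
    then show "x \<in> ?same \<union> (\<Union>z\<in>Y. closed_via G y S z) \<union> open_pairs G y S"
      using edge_ends[OF _ assms(4)] by (auto simp: closed_via_def hits_def open_pairs_def)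
  qed
  then have "card (S \<times> S) \<le> card (?same \<union> (\<Union>z\<in>Y. closed_via G y S z) \<union> open_pairs G y S)"
    using fin_open fin_same assms by (intro card_mono) auto
  also have "\<dots> \<le> card ?same + card (\<Union>z\<in>Y. closed_via G y S z) + card (open_pairs G y S)"
    by (meson add_mono card_Un_le order_refl order_trans)
  also have "\<dots> \<le> card ?same + (\<Sum>z\<in>Y. card (closed_via G y S z)) + card (open_pairs G y S)"
    using card_UN_le[OF assms(1)] by simp
  finally have "real (card (S \<times> S)) \<le> card ?same + (\<Sum>z\<in>Y. ?q z) + card (open_pairs G y S)"
    by (simp flip: of_nat_sum of_nat_add)
  then have "?a\<^sup>2 \<le> \<beta> * ?a + (\<Sum>z\<in>Y. ?q z) + card (open_pairs G y S)"
    using same by (simp add: card_cartesian_product power2_eq_square)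
  then show ?thesis using q by linarith
qed

section \<open>Open pairs in random graphs\<close>

lemma exp_le_1_plus_2: "0 \<le> x \<Longrightarrow> x \<le> 1 \<Longrightarrow> exp x \<le> 1 + 2 * x" for x :: real
  using exp_bound[of x] mult_left_le[of x x] by (simp add: power2_eq_square)

text \<open>Each prescribed edge contributes a factor \<open>p * exp 1\<close>. The remaining
  exponential factors multiply to at most \<open>exp 1\<close> by the hypothesis on the sum, and
  \<open>exp 1 \<le> 3\<close> gives 27.\<close>

lemma expec_two_edges_le:
  fixes p \<beta> :: real and f :: "'a \<Rightarrow> real"
  assumes p: "0 \<le> p" "p \<le> 1" and J: "finite J" "e1 \<in> J" "e2 \<in> J" "e1 \<noteq> e2"
    and f: "\<And>e. e \<in> J \<Longrightarrow> 0 \<le> f e" "\<And>e. e \<in> J \<Longrightarrow> f e \<le> \<beta>" and \<beta>: "0 < \<beta>"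
    and sum: "p * (\<Sum>e\<in>J. f e) \<le> \<beta> / 2"
  shows "expec p J (\<lambda>E. of_bool (e1 \<in> E \<and> e2 \<in> E) * exp ((\<Sum>e\<in>E. f e) / \<beta>)) \<le> 27 * p\<^sup>2"
proof -
  have "expec p J (\<lambda>E. of_bool (e1 \<in> E \<and> e2 \<in> E) * exp ((\<Sum>e\<in>E. f e) / \<beta>))
    = expec p J (\<lambda>E. (\<Prod>e\<in>E. exp (f e / \<beta>)) * (\<Prod>e\<in>J - E. of_bool (e \<noteq> e1 \<and> e \<noteq> e2)))"
  proof (rule expec_cong)
    fix E assume E: "E \<subseteq> J"
    then have "finite E" using J(1) by (rule finite_subset)
    then have "exp ((\<Sum>e\<in>E. f e) / \<beta>) = (\<Prod>e\<in>E. exp (f e / \<beta>))"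
      by (simp add: exp_sum sum_divide_distrib)
    moreover have "(\<Prod>e\<in>J - E. of_bool (e \<noteq> e1 \<and> e \<noteq> e2)) = (of_bool (e1 \<in> E \<and> e2 \<in> E) :: real)"
      using J E by (auto simp: prod_zero_iff intro!: prod.neutral)
    ultimately show "of_bool (e1 \<in> E \<and> e2 \<in> E) * exp ((\<Sum>e\<in>E. f e) / \<beta>)
      = (\<Prod>e\<in>E. exp (f e / \<beta>)) * (\<Prod>e\<in>J - E. of_bool (e \<noteq> e1 \<and> e \<noteq> e2))"
      by (simp only: mult.commute)
  qed
  also have "\<dots> = (\<Prod>e\<in>J. p * exp (f e / \<beta>) + (1 - p) * of_bool (e \<noteq> e1 \<and> e \<noteq> e2))"
    by (rule expec_prod) fact
  also have "\<dots> \<le> (\<Prod>e\<in>J. exp (2 * p * f e / \<beta>) * ((if e = e1 then p * exp 1 else 1) * (if e = e2 then p * exp 1 else 1)))"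
  proof (intro prod_mono conjI)
    fix e assume e: "e \<in> J"
    have x: "0 \<le> f e / \<beta>" "f e / \<beta> \<le> 1" using f[OF e] \<beta> by auto
    have pos: "1 \<le> exp (2 * p * f e / \<beta>)" using p f[OF e] \<beta> by simp
    show "p * exp (f e / \<beta>) + (1 - p) * of_bool (e \<noteq> e1 \<and> e \<noteq> e2)
      \<le> exp (2 * p * f e / \<beta>) * ((if e = e1 then p * exp 1 else 1) * (if e = e2 then p * exp 1 else 1))"
    proof (cases "e = e1 \<or> e = e2")
      case True
      have "p * exp (f e / \<beta>) \<le> p * exp 1" using p x by (intro mult_left_mono) auto
      also have "\<dots> \<le> exp (2 * p * f e / \<beta>) * (p * exp 1)"
        using pos p mult_right_mono[of 1 "exp (2 * p * f e / \<beta>)" "p * exp 1"] by simp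
      finally show ?thesis using True J by auto
    next
      case False
      have "p * exp (f e / \<beta>) + (1 - p) \<le> p * (1 + 2 * (f e / \<beta>)) + (1 - p)"
        using p exp_le_1_plus_2[OF x] by (intro add_right_mono mult_left_mono) auto
      also have "\<dots> = 1 + 2 * p * f e / \<beta>" by (simp add: algebra_simps)
      also have "\<dots> \<le> exp (2 * p * f e / \<beta>)" by (rule exp_ge_add_one_self)
      finally show ?thesis using False by simp
    qed
  qed (use p in auto)
  also have "\<dots> = exp (\<Sum>e\<in>J. 2 * p * f e / \<beta>) * ((p * exp 1) * (p * exp 1))"
    using J by (simp add: prod.distrib exp_sum)
  also have "(\<Sum>e\<in>J. 2 * p * f e / \<beta>) = 2 / \<beta> * (p * (\<Sum>e\<in>J. f e))"
    by (simp add: sum_distrib_left mult_ac)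
  also have "exp \<dots> \<le> exp 1"
    using mult_left_mono[OF sum, of "2 / \<beta>"] \<beta> by simp
  also have "exp 1 * (p * exp 1 * (p * exp 1)) \<le> 3 * (p * 3 * (p * 3 :: real))"
    using p exp_le by (intro mult_mono) auto
  finally show ?thesis using p by (simp add: power2_eq_square mult_right_mono)
qed

text \<open>By \<open>exp x \<le> 1 + x * exp x\<close> it suffices to bound
  \<open>x * exp x\<close>, where \<open>x\<close> is the closed pair count over
  \<open>T * \<beta>\<close>. At a light vertex the exponent is at most the hit count over
  \<open>\<beta>\<close>, which is linear in the edges, so its exponential factorises. The outer
  factor \<open>x\<close> is a sum over pairs of points, each treated by
  \<open>expec_two_edges_le\<close>.\<close>

lemma expec_light_closed_le:
  fixes p \<beta> T :: real
  assumes p: "0 \<le> p" "p \<le> 1" and S: "finite S" and z: "z \<notin> y ` S"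
    and fib: "\<And>u. card {v \<in> S. y v = u} \<le> \<beta>"
    and T: "0 < T" "0 < \<beta>" "p * card S \<le> \<beta> / 2"
  shows "expec p ((\<lambda>u. {z, u}) ` y ` S) (\<lambda>E. exp (light_closed T E y S z / (T * \<beta>)))
    \<le> 1 + 27 * p\<^sup>2 * (real (card S))\<^sup>2 / (T * \<beta>)"
proof -
  define J where "J = (\<lambda>u. {z, u}) ` y ` S"
  \<comment> \<open>The number of points reached through the edge \<open>e\<close>. As
    \<open>z\<close> is outside the image, the edge determines its other end, so \<open>f\<close> is
    bounded by the fibre bound \<open>\<beta>\<close>.\<close>
  define f where "f e = real (card {v \<in> S. {z, y v} = e})" for e
  define P where "P = {(v, v') \<in> S \<times> S. y v \<noteq> y v'}"
  have J: "finite J" using S by (simp add: J_def)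
  have P: "finite P" unfolding P_def using S by (auto intro: finite_subset[of _ "S \<times> S"])
  have cP: "real (card P) \<le> (real (card S))\<^sup>2"
    using card_mono[of "S \<times> S" P] S
    by (auto simp: P_def card_cartesian_product power2_eq_square simp flip: of_nat_mult)
  have f_sum: "(\<Sum>e\<in>E. f e) = card (hits E y S z)" if "finite E" for E
  proof -
    have "hits E y S z = (\<Union>e\<in>E. {v \<in> S. {z, y v} = e})" by (auto simp: hits_def)
    then have "card (hits E y S z) = (\<Sum>e\<in>E. card {v \<in> S. {z, y v} = e})"
      using that S by (simp only:) (rule card_UN_disjoint, auto)
    then show ?thesis by (simp add: f_def)
  qed
  have f_le: "f e \<le> \<beta>" if e: "e \<in> J" for e
  proof -
    from e obtain u where u: "e = {z, u}" "u \<in> y ` S" by (auto simp: J_def)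
    then have "{v \<in> S. {z, y v} = e} = {v \<in> S. y v = u}"
      using z by (auto simp: doubleton_eq_iff)
    then show ?thesis using fib by (simp add: f_def)
  qed
  have "hits J y S z = S" by (auto simp: hits_def J_def)
  then have f_J: "(\<Sum>e\<in>J. f e) = card S" using f_sum[OF J] by simp
  have "expec p J (\<lambda>E. exp (light_closed T E y S z / (T * \<beta>)))
    \<le> expec p J (\<lambda>E. 1 + 1 / (T * \<beta>) * (\<Sum>x\<in>P. of_bool ({z, y (fst x)} \<in> E \<and> {z, y (snd x)} \<in> E) * exp ((\<Sum>e\<in>E. f e) / \<beta>)))"
  proof (rule expec_mono[OF p])
    fix E assume "E \<subseteq> J"
    then have fE: "finite E" using J by (rule finite_subset)
    let ?w = "real (card (hits E y S z))"
    let ?c = "real (card (closed_via E y S z))"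
    have c: "(\<Sum>x\<in>P. of_bool ({z, y (fst x)} \<in> E \<and> {z, y (snd x)} \<in> E)) = ?c"
    proof -
      have "closed_via E y S z = {x \<in> P. {z, y (fst x)} \<in> E \<and> {z, y (snd x)} \<in> E}"
        by (auto simp: closed_via_def hits_def P_def)
      then show ?thesis using P by (simp add: of_bool_def sum.If_cases Int_def)
    qed
    have "exp (light_closed T E y S z / (T * \<beta>)) \<le> 1 + ?c / (T * \<beta>) * exp (?w / \<beta>)"
    proof (cases "?w \<le> T")
      case True
      let ?x = "?c / (T * \<beta>)"
      have "?c \<le> T * ?w"
        using card_closed_via_le[OF S, of E y z] mult_right_mono[OF True, of ?w] by (simp add: power2_eq_square)
      then have x_le: "?x \<le> ?w / \<beta>" using T by (simp add: field_simps)
      have "1 - ?x \<le> exp (- ?x)" using exp_ge_add_one_self[of "- ?x"] by simp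
      then have "exp ?x * (1 - ?x) \<le> exp ?x * exp (- ?x)" by (intro mult_left_mono) auto
      also have "exp ?x * exp (- ?x) = 1" by (simp flip: exp_add)
      finally have "exp ?x \<le> 1 + ?x * exp ?x" by (simp add: algebra_simps)
      also have "\<dots> \<le> 1 + ?x * exp (?w / \<beta>)"
        using x_le T by (intro add_left_mono mult_left_mono) auto
      finally show ?thesis using True by (simp add: light_closed_def)
    qed (use T in \<open>simp add: light_closed_def\<close>)
    then show "exp (light_closed T E y S z / (T * \<beta>))
      \<le> 1 + 1 / (T * \<beta>) * (\<Sum>x\<in>P. of_bool ({z, y (fst x)} \<in> E \<and> {z, y (snd x)} \<in> E) * exp ((\<Sum>e\<in>E. f e) / \<beta>))"
      by (simp add: f_sum[OF fE] c flip: sum_distrib_right)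
  qed
  also have "\<dots> = 1 + 1 / (T * \<beta>) * (\<Sum>x\<in>P. expec p J (\<lambda>E. of_bool ({z, y (fst x)} \<in> E \<and> {z, y (snd x)} \<in> E) * exp ((\<Sum>e\<in>E. f e) / \<beta>)))"
    by (simp only: expec_add expec_cmult expec_sum expec_const[OF J])
  also have "\<dots> \<le> 1 + 1 / (T * \<beta>) * (\<Sum>x\<in>P. 27 * p\<^sup>2)"
  proof (intro add_left_mono mult_left_mono sum_mono)
    fix x assume "x \<in> P"
    then show "expec p J (\<lambda>E. of_bool ({z, y (fst x)} \<in> E \<and> {z, y (snd x)} \<in> E) * exp ((\<Sum>e\<in>E. f e) / \<beta>)) \<le> 27 * p\<^sup>2"
      using p J f_le T z unfolding f_J[symmetric]
      by (intro expec_two_edges_le) (auto simp: P_def J_def f_def doubleton_eq_iff)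
  qed (use T in auto)
  also have "\<dots> = 1 + 27 * p\<^sup>2 / (T * \<beta>) * card P" by simp
  also have "\<dots> \<le> 1 + 27 * p\<^sup>2 / (T * \<beta>) * (real (card S))\<^sup>2"
    using cP T by (intro add_left_mono mult_left_mono) auto
  finally show ?thesis by (simp add: J_def)
qed

text \<open>Exponential Markov inequality with parameter \<open>1 / (T * \<beta>)\<close>. The
  contribution of \<open>z\<close> depends only on the edges from \<open>z\<close> to the image of
  \<open>S\<close>; for distinct \<open>z\<close> outside the image these edge sets are disjoint, so
  the moment is a product.\<close>

lemma prob_light_closed_gt:
  fixes p \<beta> T \<delta> :: real
  assumes p: "0 \<le> p" "p \<le> 1" and fin: "finite Y" "finite S" and y: "y ` S \<subseteq> Y"
    and fib: "\<And>u. card {v \<in> S. y v = u} \<le> \<beta>"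
    and T: "0 < T" "0 < \<beta>" "p * card S \<le> \<beta> / 2"
  shows "prob p ([Y]\<^bsup>2\<^esup>) (\<lambda>G. \<delta> * (real (card S))\<^sup>2 < (\<Sum>z\<in>Y - y ` S. light_closed T G y S z))
    \<le> exp ((real (card S))\<^sup>2 / (T * \<beta>) * (27 * card Y * p\<^sup>2 - \<delta>))"
proof -
  define Z where "Z = Y - y ` S"
  define J where "J z = (\<lambda>u. {z, u}) ` y ` S" for z
  define K where "K = (\<Union>z\<in>Z. J z)"
  let ?a2 = "(real (card S))\<^sup>2"
  let ?I = "[Y]\<^bsup>2\<^esup>"
  let ?f = "\<lambda>z E. exp (light_closed T E y S z / (T * \<beta>))"
  have Z: "finite Z" using fin by (simp add: Z_def)
  have K: "K \<subseteq> ?I" 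
  proof -
    have "y v \<in> Y" if "v \<in> S" for v using y that by blast
    then show ?thesis by (auto simp: K_def J_def Z_def)
  qed
  have local: "light_closed T G y S z = light_closed T (G \<inter> J z) y S z" for G z
  proof -
    have hits: "hits G y S z = hits (G \<inter> J z) y S z" by (auto simp: hits_def J_def)
    then have "closed_via G y S z = closed_via (G \<inter> J z) y S z" by (simp add: closed_via_def)
    with hits show ?thesis by (simp add: light_closed_def)
  qed
  have "prob p ?I (\<lambda>G. \<delta> * ?a2 < (\<Sum>z\<in>Z. light_closed T G y S z))
    \<le> expec p ?I (\<lambda>G. exp (- (\<delta> * ?a2 / (T * \<beta>))) * (\<Prod>z\<in>Z. ?f z ((G \<inter> K) \<inter> J z)))"
  proof (rule prob_markov[OF p])
    fix G assume "\<delta> * ?a2 < (\<Sum>z\<in>Z. light_closed T G y S z)"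
    moreover have "(\<Prod>z\<in>Z. ?f z ((G \<inter> K) \<inter> J z)) = exp ((\<Sum>z\<in>Z. light_closed T G y S z) / (T * \<beta>))"
    proof -
      have "(G \<inter> K) \<inter> J z = G \<inter> J z" if "z \<in> Z" for z using that by (auto simp: K_def)
      then have "(\<Prod>z\<in>Z. ?f z ((G \<inter> K) \<inter> J z)) = (\<Prod>z\<in>Z. ?f z (G \<inter> J z))"
        by (intro prod.cong) simp_all
      also have "\<dots> = (\<Prod>z\<in>Z. ?f z G)" by (simp flip: local)
      finally show ?thesis using Z by (simp add: exp_sum sum_divide_distrib)
    qed
    ultimately show "1 \<le> exp (- (\<delta> * ?a2 / (T * \<beta>))) * (\<Prod>z\<in>Z. ?f z ((G \<inter> K) \<inter> J z))"
      using T by (simp add: divide_right_mono flip: exp_add)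
  qed (auto intro!: mult_nonneg_nonneg prod_nonneg)
  also have "\<dots> = exp (- (\<delta> * ?a2 / (T * \<beta>))) * expec p K (\<lambda>G. \<Prod>z\<in>Z. ?f z (G \<inter> J z))"
    unfolding expec_cmult
    using expec_restrict[OF _ K, of p "\<lambda>G. \<Prod>z\<in>Z. ?f z (G \<inter> J z)"] fin
    by (simp add: finite_imp_finite_nsets)
  also have "expec p K (\<lambda>G. \<Prod>z\<in>Z. ?f z (G \<inter> J z)) = (\<Prod>z\<in>Z. expec p (J z) (?f z))"
    unfolding K_def
  proof (rule expec_prod_disjoint[OF Z])
    show "finite (J z)" for z using fin by (simp add: J_def)
    show "J z \<inter> J z' = {}" if "z \<in> Z" "z' \<in> Z" "z \<noteq> z'" for z z'
      using that by (auto simp: J_def Z_def doubleton_eq_iff)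
  qed
  also have "\<dots> \<le> (\<Prod>z\<in>Z. exp (27 * p\<^sup>2 * ?a2 / (T * \<beta>)))"
  proof (intro prod_mono conjI)
    fix z assume "z \<in> Z"
    then have "expec p (J z) (?f z) \<le> 1 + 27 * p\<^sup>2 * ?a2 / (T * \<beta>)"
      unfolding J_def using p fin fib T by (intro expec_light_closed_le) (auto simp: Z_def)
    also have "\<dots> \<le> exp (27 * p\<^sup>2 * ?a2 / (T * \<beta>))" by (rule exp_ge_add_one_self)
    finally show "expec p (J z) (?f z) \<le> exp (27 * p\<^sup>2 * ?a2 / (T * \<beta>))" .
  qed (use p in \<open>auto intro: expec_nonneg\<close>)
  also have "\<dots> = exp (card Z * (27 * p\<^sup>2 * ?a2 / (T * \<beta>)))"
    by (simp only: prod_constant exp_of_nat_mult)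
  also have "\<dots> \<le> exp (card Y * (27 * p\<^sup>2 * ?a2 / (T * \<beta>)))"
  proof -
    have "card Z \<le> card Y" using fin by (auto simp: Z_def intro: card_mono)
    then show ?thesis using T unfolding exp_le_cancel_iff by (intro mult_right_mono) auto
  qed
  finally have "prob p ?I (\<lambda>G. \<delta> * ?a2 < (\<Sum>z\<in>Z. light_closed T G y S z))
    \<le> exp (- (\<delta> * ?a2 / (T * \<beta>))) * exp (card Y * (27 * p\<^sup>2 * ?a2 / (T * \<beta>)))" by simp
  also have "\<dots> = exp (?a2 / (T * \<beta>) * (27 * card Y * p\<^sup>2 - \<delta>))"
    using T by (simp add: field_simps flip: exp_add)
  finally show ?thesis by (simp add: Z_def)
qed

section \<open>Degrees, codegrees and the union bound over all sets \<open>S\<close>\<close>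

lemma card_nsets_le_power: "card ([V]\<^bsup>a\<^esup>) \<le> card V ^ a"
  by (cases "a \<le> card V") (auto simp: binomial_le_pow binomial_eq_0)

lemma prob_degree_ge:
  fixes p :: real
  assumes p: "0 \<le> p" "p \<le> 1" and Y: "finite Y" "z \<in> Y"
  shows "prob p ([Y]\<^bsup>2\<^esup>) (\<lambda>G. 11 / 10 * (p * card Y) \<le> card {u \<in> Y. {z, u} \<in> G}) \<le> exp (- (p * card Y / 400))"
proof -
  define J where "J = (\<lambda>u. {z, u}) ` (Y - {z})"
  have J: "J \<subseteq> [Y]\<^bsup>2\<^esup>" using Y by (auto simp: J_def)
  have "card J \<le> card (Y - {z})" unfolding J_def using Y by (intro card_image_le) auto
  also have "\<dots> \<le> card Y" using Y by (intro card_mono) auto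
  finally have cJ: "card J \<le> card Y" .
  have deg: "card {u \<in> Y. {z, u} \<in> G} = card (G \<inter> J)" if "G \<subseteq> [Y]\<^bsup>2\<^esup>" for G
  proof -
    have "bij_betw (\<lambda>u. {z, u}) {u \<in> Y. {z, u} \<in> G} (G \<inter> J)"
      using edge_ends(3)[OF _ that] by (auto simp: bij_betw_def inj_on_def J_def doubleton_eq_iff)
    then show ?thesis by (rule bij_betw_same_card)
  qed
  have "prob p ([Y]\<^bsup>2\<^esup>) (\<lambda>G. 11 / 10 * (p * card Y) \<le> card {u \<in> Y. {z, u} \<in> G})
    \<le> prob p ([Y]\<^bsup>2\<^esup>) (\<lambda>G. 11 / 10 * (p * card Y) \<le> card (G \<inter> J))"
    using p deg by (intro prob_mono) auto
  also have "\<dots> \<le> exp (- (p * card Y / 400))"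
    using p Y J cJ by (intro prob_card_ge_mean finite_imp_finite_nsets)
  finally show ?thesis .
qed

text \<open>Union bound over the possible \<open>j\<close>-sets of common neighbours: such a set
  requires \<open>2 * j\<close> distinct edges.\<close>

lemma prob_codegree_ge:
  fixes p :: real
  assumes p: "0 \<le> p" "p \<le> 1" and Y: "finite Y" "z \<in> Y" "z' \<in> Y" "z \<noteq> z'"
  shows "prob p ([Y]\<^bsup>2\<^esup>) (\<lambda>G. j \<le> card {u \<in> Y. {z, u} \<in> G \<and> {z', u} \<in> G}) \<le> (card Y * p\<^sup>2) ^ j"
proof -
  define J where "J U = (\<lambda>u. {z, u}) ` U \<union> (\<lambda>u. {z', u}) ` U" for U
  let ?A = "[Y - {z, z'}]\<^bsup>j\<^esup>"
  have "prob p ([Y]\<^bsup>2\<^esup>) (\<lambda>G. j \<le> card {u \<in> Y. {z, u} \<in> G \<and> {z', u} \<in> G})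
    \<le> prob p ([Y]\<^bsup>2\<^esup>) (\<lambda>G. \<exists>U\<in>?A. J U \<subseteq> G)"
  proof (rule prob_mono[OF p])
    fix G assume G: "G \<subseteq> [Y]\<^bsup>2\<^esup>" and le: "j \<le> card {u \<in> Y. {z, u} \<in> G \<and> {z', u} \<in> G}"
    from le obtain U where U: "U \<subseteq> {u \<in> Y. {z, u} \<in> G \<and> {z', u} \<in> G}" "card U = j" "finite U"
      by (rule obtain_subset_with_card_n)
    moreover have "U \<subseteq> Y - {z, z'}" using U edge_ends(3)[OF _ G] by blast
    ultimately show "\<exists>U\<in>?A. J U \<subseteq> G" by (intro bexI[of _ U]) (auto simp: nsets_def J_def)
  qed
  also have "\<dots> \<le> real (card ?A) * (p\<^sup>2) ^ j"
  proof (rule prob_Bex_const[OF p])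
    fix U assume U: "U \<in> ?A"
    then have fU: "finite U" "card U = j" "U \<subseteq> Y" "z \<notin> U" "z' \<notin> U" by (auto simp: nsets_def)
    have "card (J U) = card ((\<lambda>u. {z, u}) ` U) + card ((\<lambda>u. {z', u}) ` U)"
      unfolding J_def using fU Y by (intro card_Un_disjoint) (auto simp: doubleton_eq_iff)
    also have "\<dots> = j + j"
      using fU by (subst (1 2) card_image) (auto simp: inj_on_def doubleton_eq_iff)
    finally have "card (J U) = 2 * j" by simp
    moreover have "J U \<subseteq> [Y]\<^bsup>2\<^esup>" using fU Y by (auto simp: J_def)
    ultimately show "prob p ([Y]\<^bsup>2\<^esup>) ((\<subseteq>) (J U)) \<le> (p\<^sup>2) ^ j"
      using Y prob_contains[of "[Y]\<^bsup>2\<^esup>" "J U" p] by (simp add: finite_imp_finite_nsets power_mult)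
  qed (use Y in \<open>auto intro: finite_imp_finite_nsets\<close>)
  also have "\<dots> \<le> card Y ^ j * (p\<^sup>2) ^ j"
  proof (rule mult_right_mono)
    have "card ?A \<le> card ([Y]\<^bsup>j\<^esup>)"
      using Y by (intro card_mono nsets_mono finite_imp_finite_nsets) auto
    also have "\<dots> \<le> card Y ^ j" by (rule card_nsets_le_power)
    finally show "real (card ?A) \<le> real (card Y ^ j)" by simp
  qed simp
  finally show ?thesis by (simp add: power_mult_distrib)
qed

text \<open>Chernoff bound with \<theta> = 1: the factor \<open>exp 1 - 1\<close>, at most 2,
  cancels the 1/2 in the number of pairs.\<close>

lemma prob_edges_within_ge:
  fixes p M :: real
  assumes p: "0 \<le> p" "p \<le> 1" and Y: "finite Y" "B \<subseteq> Y" "card B \<le> a"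
  shows "prob p ([Y]\<^bsup>2\<^esup>) (\<lambda>G. M \<le> card (G \<inter> [B]\<^bsup>2\<^esup>)) \<le> exp (p * (real a)\<^sup>2 - M)"
proof -
  have "prob p ([Y]\<^bsup>2\<^esup>) (\<lambda>G. M \<le> card (G \<inter> [B]\<^bsup>2\<^esup>))
    \<le> exp (p * card ([B]\<^bsup>2\<^esup>) * (exp 1 - 1) - 1 * M)"
    using p Y by (intro prob_card_ge nsets_mono finite_imp_finite_nsets) auto
  also have "\<dots> \<le> exp (p * (real a)\<^sup>2 - M)"
  proof -
    have "2 * card ([B]\<^bsup>2\<^esup>) = 2 * (card B * (card B - 1) div 2)" by (simp add: choose_two)
    also have "\<dots> \<le> card B * (card B - 1)" by (rule times_div_less_eq_dividend)
    also have "\<dots> \<le> card B * card B" by (rule mult_le_mono) auto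
    also have "\<dots> \<le> a * a" using Y by (intro mult_le_mono)
    finally have "2 * real (card ([B]\<^bsup>2\<^esup>)) \<le> (real a)\<^sup>2"
      by (simp only: power2_eq_square flip: of_nat_mult of_nat_numeral[where 'a = real] of_nat_le_iff[where 'a = real])
    moreover have "p * card ([B]\<^bsup>2\<^esup>) * (exp 1 - 1) \<le> p * card ([B]\<^bsup>2\<^esup>) * 2"
      using p exp_le by (intro mult_left_mono) auto
    moreover have "p * (2 * real (card ([B]\<^bsup>2\<^esup>))) \<le> p * (real a)\<^sup>2"
      using calculation p by (intro mult_left_mono) auto
    ultimately show ?thesis by simp
  qed
  finally show ?thesis .
qed

text \<open>Four events can spoil the count: a large degree, a large codegree, many edges inside an
  image, or many light closed pairs. The first two range over vertices and pairs of
  \<open>Y\<close>; only the last two pay for all \<open>a\<close>-sets.\<close>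

lemma prob_few_open_pairs:
  fixes p \<beta> T \<delta> M m :: real and a j :: nat
  assumes p: "0 \<le> p" "p \<le> 1" and fin: "finite Y" "finite V" and y: "y ` V \<subseteq> Y"
    and fib: "\<And>u. card {v \<in> V. y v = u} \<le> \<beta>"
    and T: "0 < T" "0 < \<beta>" "p * a \<le> \<beta> / 2" "10 * a * (\<beta> * j) \<le> T\<^sup>2"
  defines "m \<equiv> (real a)\<^sup>2 - \<beta> * a - 10 / 9 * (\<beta> * (11 / 10 * (p * card Y))) * a
    - 2 * T * \<beta> * M - \<delta> * (real a)\<^sup>2"
  shows "prob p ([Y]\<^bsup>2\<^esup>) (\<lambda>G. \<exists>S\<in>[V]\<^bsup>a\<^esup>. card (open_pairs G y S) < m)
    \<le> card Y * exp (- (p * card Y / 400)) + (real (card Y))\<^sup>2 * (card Y * p\<^sup>2) ^ j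
      + real (card V) ^ a * (exp (p * (real a)\<^sup>2 - M)
      + exp ((real a)\<^sup>2 / (T * \<beta>) * (27 * card Y * p\<^sup>2 - \<delta>)))"
proof -
  let ?I = "[Y]\<^bsup>2\<^esup>"
  let ?deg = "\<lambda>G. \<exists>z\<in>Y. 11 / 10 * (p * card Y) \<le> card {u \<in> Y. {z, u} \<in> G}"
  let ?codeg = "\<lambda>G. \<exists>x\<in>{(z, z'). z \<in> Y \<and> z' \<in> Y \<and> z \<noteq> z'}. j \<le> card {u \<in> Y. {fst x, u} \<in> G \<and> {snd x, u} \<in> G}"
  let ?sp = "\<lambda>G. \<exists>S\<in>[V]\<^bsup>a\<^esup>. M \<le> card (G \<inter> [y ` S]\<^bsup>2\<^esup>)"
  let ?li = "\<lambda>G. \<exists>S\<in>[V]\<^bsup>a\<^esup>. \<delta> * (real (card S))\<^sup>2 < (\<Sum>z\<in>Y - y ` S. light_closed T G y S z)"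
  have S: "finite S" "card S = a" "y ` S \<subseteq> Y" "\<And>u. card {v \<in> S. y v = u} \<le> \<beta>" if "S \<in> [V]\<^bsup>a\<^esup>" for S
  proof -
    show *: "finite S" "card S = a" "y ` S \<subseteq> Y" using that y by (auto simp: nsets_def)
    fix u
    have "card {v \<in> S. y v = u} \<le> card {v \<in> V. y v = u}"
      using that fin by (intro card_mono) (auto simp: nsets_def)
    then show "card {v \<in> S. y v = u} \<le> \<beta>" using fib[of u] by linarith
  qed
  have fV: "finite ([V]\<^bsup>a\<^esup>)" using fin by (intro finite_imp_finite_nsets)
  have cV: "real (card ([V]\<^bsup>a\<^esup>)) \<le> real (card V) ^ a"
    using card_nsets_le_power[of V a] by (simp only: of_nat_power [symmetric] of_nat_le_iff)
  have fP: "finite {(z, z'). z \<in> Y \<and> z' \<in> Y \<and> z \<noteq> z'}"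
    by (rule finite_subset[of _ "Y \<times> Y"]) (use fin in auto)
  have cP: "real (card {(z, z'). z \<in> Y \<and> z' \<in> Y \<and> z \<noteq> z'}) \<le> (real (card Y))\<^sup>2"
  proof -
    have "card {(z, z'). z \<in> Y \<and> z' \<in> Y \<and> z \<noteq> z'} \<le> card (Y \<times> Y)"
      by (rule card_mono) (use fin in auto)
    then show ?thesis by (simp add: card_cartesian_product power2_eq_square flip: of_nat_mult)
  qed
  have "prob p ?I (\<lambda>G. \<exists>S\<in>[V]\<^bsup>a\<^esup>. card (open_pairs G y S) < m)
    \<le> prob p ?I (\<lambda>G. ?deg G \<or> ?codeg G \<or> ?sp G \<or> ?li G)"
  proof (rule prob_mono[OF p], rule ccontr)
    fix G assume G: "G \<subseteq> ?I" and ex: "\<exists>S\<in>[V]\<^bsup>a\<^esup>. card (open_pairs G y S) < m"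
      and no: "\<not> (?deg G \<or> ?codeg G \<or> ?sp G \<or> ?li G)"
    from ex obtain S where SV: "S \<in> [V]\<^bsup>a\<^esup>" and lt: "card (open_pairs G y S) < m" by blast
    have "m \<le> card (open_pairs G y S)"
      unfolding m_def S(2)[OF SV, symmetric]
    proof (rule card_open_pairs_ge[where Y = Y and c = j])
      show "real (card {u \<in> Y. {z, u} \<in> G}) \<le> 11 / 10 * (p * card Y)" if "z \<in> Y" for z
        using no that by force
      show "real (card {u \<in> Y. {z, u} \<in> G \<and> {z', u} \<in> G}) \<le> j" if "z \<in> Y" "z' \<in> Y" "z \<noteq> z'" for z z'
      proof -
        have "\<not> j \<le> card {u \<in> Y. {fst (z, z'), u} \<in> G \<and> {snd (z, z'), u} \<in> G}"
          using no that by blast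
        then show ?thesis by simp
      qed
      have "\<not> M \<le> card (G \<inter> [y ` S]\<^bsup>2\<^esup>)" using no SV by blast
      then show "real (card (G \<inter> [y ` S]\<^bsup>2\<^esup>)) \<le> M" by linarith
      have "\<not> \<delta> * (real (card S))\<^sup>2 < (\<Sum>z\<in>Y - y ` S. light_closed T G y S z)"
        using no SV by blast
      then show "(\<Sum>z\<in>Y - y ` S. light_closed T G y S z) \<le> \<delta> * (real (card S))\<^sup>2" by linarith
    qed (use G fin S[OF SV] T p in auto)
    with lt show False by simp
  qed
  also have "\<dots> \<le> prob p ?I ?deg + (prob p ?I ?codeg + (prob p ?I ?sp + prob p ?I ?li))"
    by (intro order_trans[OF prob_disj_le[OF p]] add_left_mono order_refl)
  also have "\<dots> \<le> card Y * exp (- (p * card Y / 400)) + ((real (card Y))\<^sup>2 * (card Y * p\<^sup>2) ^ j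
      + (real (card V) ^ a * exp (p * (real a)\<^sup>2 - M)
      + real (card V) ^ a * exp ((real a)\<^sup>2 / (T * \<beta>) * (27 * card Y * p\<^sup>2 - \<delta>))))"
  proof (intro add_mono)
    show "prob p ?I ?deg \<le> card Y * exp (- (p * card Y / 400))"
      using p fin by (intro prob_Bex_const prob_degree_ge)
    have "prob p ?I ?codeg \<le> real (card {(z, z'). z \<in> Y \<and> z' \<in> Y \<and> z \<noteq> z'}) * (card Y * p\<^sup>2) ^ j"
      using p fin fP by (intro prob_Bex_const prob_codegree_ge) auto
    also have "\<dots> \<le> (real (card Y))\<^sup>2 * (card Y * p\<^sup>2) ^ j"
      using p cP by (intro mult_right_mono) auto
    finally show "prob p ?I ?codeg \<le> (real (card Y))\<^sup>2 * (card Y * p\<^sup>2) ^ j" .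
    have "prob p ?I ?sp \<le> real (card ([V]\<^bsup>a\<^esup>)) * exp (p * (real a)\<^sup>2 - M)"
    proof (rule prob_Bex_const[OF p fV])
      fix S assume SV: "S \<in> [V]\<^bsup>a\<^esup>"
      show "prob p ?I (\<lambda>G. M \<le> card (G \<inter> [y ` S]\<^bsup>2\<^esup>)) \<le> exp (p * (real a)\<^sup>2 - M)"
        using p fin S[OF SV] card_image_le[OF S(1)[OF SV], of y] by (intro prob_edges_within_ge) auto
    qed
    also have "\<dots> \<le> real (card V) ^ a * exp (p * (real a)\<^sup>2 - M)"
      using cV by (intro mult_right_mono) auto
    finally show "prob p ?I ?sp \<le> real (card V) ^ a * exp (p * (real a)\<^sup>2 - M)" .
    have "prob p ?I ?li \<le> real (card ([V]\<^bsup>a\<^esup>)) * exp ((real a)\<^sup>2 / (T * \<beta>) * (27 * card Y * p\<^sup>2 - \<delta>))"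
    proof (rule prob_Bex_const[OF p fV])
      fix S assume SV: "S \<in> [V]\<^bsup>a\<^esup>"
      show "prob p ?I (\<lambda>G. \<delta> * (real (card S))\<^sup>2 < (\<Sum>z\<in>Y - y ` S. light_closed T G y S z))
        \<le> exp ((real a)\<^sup>2 / (T * \<beta>) * (27 * card Y * p\<^sup>2 - \<delta>))"
        using prob_light_closed_gt[of p Y S y \<beta> T \<delta>] p fin S[OF SV] T by simp
    qed
    also have "\<dots> \<le> real (card V) ^ a * exp ((real a)\<^sup>2 / (T * \<beta>) * (27 * card Y * p\<^sup>2 - \<delta>))"
      using cV by (intro mult_right_mono) auto
    finally show "prob p ?I ?li \<le> real (card V) ^ a * exp ((real a)\<^sup>2 / (T * \<beta>) * (27 * card Y * p\<^sup>2 - \<delta>))" .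
  qed
  finally show ?thesis by (simp add: algebra_simps)
qed

section \<open>Random points and random pairs of graphs\<close>

text \<open>\<open>V\<close> is a random subset of the grid with density \<open>q\<close>. The three
  summands in \<open>small\<close> bound the probability of too few points, of an overfull row or
  column, and of \<open>k\<close> points inside some \<open>a\<close> by \<open>a\<close>
  box.\<close>

lemma exists_spread_points:
  fixes q :: real and s a k n :: nat
  assumes q: "0 \<le> q" "q \<le> 1" and as: "a \<le> s"
    and small: "exp (n / 10 - 19 / 200 * (q * (real s)\<^sup>2)) + 2 * s * exp (- (q * s / 400))
      + (real (s choose a))\<^sup>2 * real (a\<^sup>2 choose k) * q ^ k < 1"
  obtains V where "V \<subseteq> {..<s} \<times> {..<s}" "n \<le> card V"
    "\<And>u. card {v \<in> V. fst v = u} \<le> 11 / 10 * (q * s)"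
    "\<And>u. card {v \<in> V. snd v = u} \<le> 11 / 10 * (q * s)"
    "\<And>S. S \<subseteq> V \<Longrightarrow> card S = k \<Longrightarrow> a \<le> card (fst ` S) \<or> a \<le> card (snd ` S)"
proof -
  let ?X = "{..<s}"
  let ?I = "?X \<times> ?X"
  have I: "finite ?I" "card ?I = s\<^sup>2" by (simp_all add: card_cartesian_product power2_eq_square)
  let ?few = "\<lambda>E. card (E \<inter> ?I) \<le> real n"
  let ?line = "\<lambda>E. \<exists>J\<in>(\<lambda>u. {u} \<times> ?X) ` ?X \<union> (\<lambda>u. ?X \<times> {u}) ` ?X. 11 / 10 * (q * s) \<le> card (E \<inter> J)"
  let ?D = "\<Union>x\<in>[?X]\<^bsup>a\<^esup> \<times> [?X]\<^bsup>a\<^esup>. [fst x \<times> snd x]\<^bsup>k\<^esup>"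
  let ?dense = "\<lambda>E. \<exists>S\<in>?D. S \<subseteq> E"
  have few: "prob q ?I ?few \<le> exp (n / 10 - 19 / 200 * (q * (real s)\<^sup>2))"
  proof -
    have "prob q ?I ?few \<le> exp (1 / 10 * n - q * card ?I * (1 - exp (- (1 / 10))))"
      using q I by (intro prob_card_le) auto
    \<comment> \<open>The quadratic Taylor bound gives 200/221, barely below 181/200; hence the
      constant 19/200.\<close>
    moreover have "exp (- (1 / 10)) \<le> (181 / 200 :: real)"
    proof -
      have "221 / 200 \<le> exp (1 / 10 :: real)"
        using exp_lower_Taylor_quadratic[of "1 / 10"] by (simp add: power2_eq_square)
      then have "1 / exp (1 / 10 :: real) \<le> 1 / (221 / 200)" by (intro divide_left_mono) auto
      then show ?thesis by (simp add: exp_minus inverse_eq_divide)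
    qed
    then have "q * card ?I * (19 / 200) \<le> q * card ?I * (1 - exp (- (1 / 10)))"
      using q by (intro mult_left_mono) auto
    ultimately show ?thesis unfolding I(2) by (elim order_trans) simp
  qed
  have line: "prob q ?I ?line \<le> 2 * s * exp (- (q * s / 400))"
  proof -
    have fin: "finite ((\<lambda>u. {u} \<times> ?X) ` ?X \<union> (\<lambda>u. ?X \<times> {u}) ` ?X)" by simp
    have "prob q ?I ?line \<le> real (card ((\<lambda>u. {u} \<times> ?X) ` ?X \<union> (\<lambda>u. ?X \<times> {u}) ` ?X)) * exp (- (q * s / 400))"
    proof (rule prob_Bex_const[OF q fin])
      fix J assume "J \<in> (\<lambda>u. {u} \<times> ?X) ` ?X \<union> (\<lambda>u. ?X \<times> {u}) ` ?X"
      then have J: "J \<subseteq> ?I" "card J = s" by (auto simp: card_cartesian_product)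
      then show "prob q ?I (\<lambda>E. 11 / 10 * (q * s) \<le> card (E \<inter> J)) \<le> exp (- (q * s / 400))"
        using q I by (intro prob_card_ge_mean) auto
    qed
    also have "\<dots> \<le> 2 * s * exp (- (q * s / 400))"
    proof (rule mult_right_mono)
      have "card ((\<lambda>u. {u} \<times> ?X) ` ?X \<union> (\<lambda>u. ?X \<times> {u}) ` ?X)
        \<le> card ((\<lambda>u. {u} \<times> ?X) ` ?X) + card ((\<lambda>u. ?X \<times> {u}) ` ?X)" by (rule card_Un_le)
      also have "\<dots> \<le> s + s"
        using card_image_le[of ?X "\<lambda>u. {u} \<times> ?X"] card_image_le[of ?X "\<lambda>u. ?X \<times> {u}"] by simp
      finally show "real (card ((\<lambda>u. {u} \<times> ?X) ` ?X \<union> (\<lambda>u. ?X \<times> {u}) ` ?X)) \<le> 2 * s" by simp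
    qed simp
    finally show ?thesis .
  qed
  have dense: "prob q ?I ?dense \<le> (real (s choose a))\<^sup>2 * real (a\<^sup>2 choose k) * q ^ k"
  proof -
    have fin: "finite ([?X]\<^bsup>a\<^esup> \<times> [?X]\<^bsup>a\<^esup>)" by (simp add: finite_imp_finite_nsets)
    have fD: "finite ?D"
      by (intro finite_UN_I[OF fin] finite_imp_finite_nsets) (auto simp: nsets_def)
    have "prob q ?I ?dense \<le> real (card ?D) * q ^ k"
    proof (rule prob_Bex_const[OF q fD])
      fix S assume "S \<in> ?D"
      then have "card S = k" "S \<subseteq> ?I" by (fastforce simp: nsets_def)+
      then show "prob q ?I ((\<subseteq>) S) \<le> q ^ k" using prob_contains[OF I(1), of S q] by simp
    qed
    also have "\<dots> \<le> (real (s choose a))\<^sup>2 * real (a\<^sup>2 choose k) * q ^ k"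
    proof (rule mult_right_mono)
      have "card ?D \<le> (\<Sum>x\<in>[?X]\<^bsup>a\<^esup> \<times> [?X]\<^bsup>a\<^esup>. card ([fst x \<times> snd x]\<^bsup>k\<^esup>))"
        by (rule card_UN_le[OF fin])
      also have "\<dots> = (\<Sum>x\<in>[?X]\<^bsup>a\<^esup> \<times> [?X]\<^bsup>a\<^esup>. a\<^sup>2 choose k)"
        by (rule sum.cong) (auto simp: nsets_def[of _ a] card_cartesian_product power2_eq_square)
      also have "\<dots> = (s choose a)\<^sup>2 * (a\<^sup>2 choose k)"
        by (simp add: card_cartesian_product power2_eq_square)
      finally show "real (card ?D) \<le> (real (s choose a))\<^sup>2 * real (a\<^sup>2 choose k)"
        by (simp flip: of_nat_mult of_nat_power)
    qed (use q in auto)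
    finally show ?thesis .
  qed
  have "prob q ?I (\<lambda>E. ?few E \<or> ?line E \<or> ?dense E) \<le> prob q ?I ?few + (prob q ?I ?line + prob q ?I ?dense)"
    by (intro order_trans[OF prob_disj_le[OF q]] add_left_mono order_refl)
  also have "\<dots> < 1" using few line dense small by linarith
  finally obtain V where V: "V \<subseteq> ?I" and no: "\<not> (?few V \<or> ?line V \<or> ?dense V)"
    using prob_less_1_obtains[OF I(1) q] by blast
  have fV: "finite V" using V I(1) by (rule finite_subset)
  show ?thesis
  proof (rule that[OF V])
    show "n \<le> card V" using no V by (simp add: Int_absorb2)
    show "card {v \<in> V. fst v = u} \<le> 11 / 10 * (q * s)" for u
    proof (cases "u < s")
      case True
      have "{v \<in> V. fst v = u} = V \<inter> ({u} \<times> ?X)" using V by auto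
      moreover have "\<not> 11 / 10 * (q * s) \<le> card (V \<inter> ({u} \<times> ?X))" using no True by blast
      ultimately show ?thesis by simp
    next
      case False
      then have "{v \<in> V. fst v = u} = {}" using V by auto
      then show ?thesis using q by (simp only: card.empty) simp
    qed
    show "card {v \<in> V. snd v = u} \<le> 11 / 10 * (q * s)" for u
    proof (cases "u < s")
      case True
      have "{v \<in> V. snd v = u} = V \<inter> (?X \<times> {u})" using V by auto
      moreover have "\<not> 11 / 10 * (q * s) \<le> card (V \<inter> (?X \<times> {u}))" using no True by blast
      ultimately show ?thesis by simp
    next
      case False
      then have "{v \<in> V. snd v = u} = {}" using V by auto
      then show ?thesis using q by (simp only: card.empty) simp
    qed
    fix S assume S: "S \<subseteq> V" "card S = k"
    show "a \<le> card (fst ` S) \<or> a \<le> card (snd ` S)"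
    proof (rule ccontr)
      assume "\<not> ?thesis"
      then have less: "card (fst ` S) \<le> a" "card (snd ` S) \<le> a" by auto
      have fS: "finite S" using S(1) fV by (rule finite_subset)
      have sub: "fst ` S \<subseteq> ?X" "snd ` S \<subseteq> ?X" using S V by auto
      \<comment> \<open>Both projections are enlarged to exactly \<open>a\<close> elements, possible
        since \<open>a \<le> s\<close>, so that \<open>S\<close> lies in one of the boxes of the
        union bound.\<close>
      obtain A where A: "fst ` S \<subseteq> A" "A \<subseteq> ?X" "card A = a"
        using exists_subset_between[OF less(1) _ sub(1)] as by auto
      obtain B where B: "snd ` S \<subseteq> B" "B \<subseteq> ?X" "card B = a"
        using exists_subset_between[OF less(2) _ sub(2)] as by auto
      have fin: "finite A" "finite B" using A B by (auto intro: finite_subset)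
      have "S \<subseteq> A \<times> B" using A B by force
      then have "S \<in> [A \<times> B]\<^bsup>k\<^esup>" using fS S by (simp add: nsets_def)
      moreover have "(A, B) \<in> [?X]\<^bsup>a\<^esup> \<times> [?X]\<^bsup>a\<^esup>" using A B fin by (simp add: nsets_def)
      ultimately have "S \<in> ?D" by fastforce
      then show False using no S by blast
    qed
  qed
qed

text \<open>With \<open>H\<close> fixed the open pairs are fixed, and an injective \<open>x\<close>
  turns them into at least \<open>m / 2\<close> potential edges of \<open>G\<close>. The triangle
  correction reduces the exponent by at most a tenth, so 9/20 is half of 9/10.\<close>

lemma prob_no_surviving_edge:
  fixes p m :: real
  assumes p: "0 \<le> p" "p < 1" and fin: "finite Y" "finite V" and x: "x ` V \<subseteq> Y"
    and T: "\<And>G. G \<subseteq> [Y]\<^bsup>2\<^esup> \<Longrightarrow> edge_packing G (T G)"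
    and small: "card Y * p\<^sup>2 / (1 - p) ^ 3 \<le> 1 / 10"
    and m: "\<And>S. S \<in> [V]\<^bsup>a\<^esup> \<Longrightarrow> m \<le> card (open_pairs H y S)"
  shows "prob p ([Y]\<^bsup>2\<^esup>) (\<lambda>G. \<exists>S\<in>[V]\<^bsup>a\<^esup>. inj_on x S \<and>
      (\<lambda>(v, w). {x v, x w}) ` open_pairs H y S \<inter> G \<subseteq> edges_of (T G))
    \<le> real (card V) ^ a * exp (- (9 / 20 * p * m))"
proof -
  let ?I = "[Y]\<^bsup>2\<^esup>"
  let ?F = "\<lambda>S. (\<lambda>(v, w). {x v, x w}) ` open_pairs H y S"
  have fV: "finite ([V]\<^bsup>a\<^esup>)" using fin by (intro finite_imp_finite_nsets)
  have cV: "real (card ([V]\<^bsup>a\<^esup>)) \<le> real (card V) ^ a"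
    using card_nsets_le_power[of V a] by (simp only: of_nat_power [symmetric] of_nat_le_iff)
  have "prob p ?I (\<lambda>G. \<exists>S\<in>[V]\<^bsup>a\<^esup>. inj_on x S \<and> ?F S \<inter> G \<subseteq> edges_of (T G))
    \<le> real (card ([V]\<^bsup>a\<^esup>)) * exp (- (9 / 20 * p * m))"
  proof (rule prob_Bex_const[OF _ _ fV])
    fix S assume S: "S \<in> [V]\<^bsup>a\<^esup>"
    show "prob p ?I (\<lambda>G. inj_on x S \<and> ?F S \<inter> G \<subseteq> edges_of (T G)) \<le> exp (- (9 / 20 * p * m))"
    proof (cases "inj_on x S")
      case False
      then have "prob p ?I (\<lambda>G. inj_on x S \<and> ?F S \<inter> G \<subseteq> edges_of (T G)) = expec p ?I (\<lambda>_. 0)"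
        unfolding prob_def by simp
      also have "\<dots> = 0" using fin by (intro expec_const finite_imp_finite_nsets)
      finally show ?thesis by simp
    next
      case inj: True
      have SV: "S \<subseteq> V" "finite S" using S by (auto simp: nsets_def)
      let ?P = "open_pairs H y S"
      have P: "?P \<subseteq> S \<times> S" by (auto simp: open_pairs_def)
      then have fP: "finite ?P" using SV by (auto intro: finite_subset)
      have "inj_on (map_prod x x) ?P" using map_prod_inj_on[OF inj inj] P by (rule inj_on_subset)
      then have "card ?P = card (map_prod x x ` ?P)" by (simp add: card_image)
      also have "\<dots> \<le> 2 * card ((\<lambda>(u, v). {u, v}) ` map_prod x x ` ?P)"
        using fP by (intro card_pairs_le) auto
      also have "(\<lambda>(u, v). {u, v}) ` map_prod x x ` ?P = ?F S" by (force simp: image_image)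
      finally have "m \<le> 2 * real (card (?F S))" using m[OF S] by linarith
      have F: "?F S \<subseteq> ?I"
      proof -
        have "x v \<in> Y" if "v \<in> S" for v using that SV x by blast
        moreover have "x v \<noteq> x w" if "(v, w) \<in> ?P" for v w
          using that inj by (auto simp: open_pairs_def dest: inj_onD)
        ultimately show ?thesis using P by auto
      qed
      have "prob p ?I (\<lambda>G. inj_on x S \<and> ?F S \<inter> G \<subseteq> edges_of (T G))
        \<le> (1 - p) ^ card (?F S) * exp (card (?F S) * card Y * (p / (1 - p)) ^ 3)"
        using prob_edge_packing_covers[OF p fin(1) F T] inj by simp
      also have "\<dots> \<le> exp (- p) ^ card (?F S) * exp (card (?F S) * card Y * (p / (1 - p)) ^ 3)"
        using p exp_ge_add_one_self[of "- p"] by (intro mult_right_mono power_mono) auto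
      also have "\<dots> = exp (- (p * card (?F S) * (1 - card Y * p\<^sup>2 / (1 - p) ^ 3)))"
        by (simp flip: exp_of_nat_mult exp_add add: field_simps power2_eq_square power3_eq_cube power_divide)
      also have "\<dots> \<le> exp (- (p * (m / 2) * (9 / 10)))"
      proof -
        have "p * (m / 2) * (9 / 10) \<le> p * card (?F S) * (9 / 10)"
          using p \<open>m \<le> 2 * real (card (?F S))\<close> by (intro mult_right_mono mult_left_mono) auto
        also have "\<dots> \<le> p * card (?F S) * (1 - card Y * p\<^sup>2 / (1 - p) ^ 3)"
          using p small by (intro mult_left_mono) auto
        finally show ?thesis by simp
      qed
      finally show ?thesis by (simp add: mult_ac)
    qed
  qed (use p in auto)
  also have "\<dots> \<le> real (card V) ^ a * exp (- (9 / 20 * p * m))"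
    using cV by (intro mult_right_mono) auto
  finally show ?thesis .
qed

section \<open>Choosing both graphs simultaneously\<close>

lemma expec_swap:
  "expec p I (\<lambda>A. expec q J (f A)) = expec q J (\<lambda>B. expec p I (\<lambda>A. f A B))"
  unfolding expec_def sum_distrib_left by (subst sum.swap) (simp add: mult_ac)

text \<open>Four failure probabilities, two below 1/4 and two at most 1/4, add up to less than 1.
  \<open>R1\<close> is averaged over \<open>G\<close> for fixed good \<open>H\<close>, and
  \<open>R2\<close> over \<open>H\<close> for fixed good \<open>G\<close>; exchanging the order of
  expectation makes both conditional bounds usable.\<close>

lemma exists_independent_pair:
  fixes p :: real
  assumes I: "finite I" and p: "0 \<le> p" "p \<le> 1"
    and N: "prob p I N1 < 1 / 4" "prob p I N2 < 1 / 4"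
    and R1: "\<And>H. H \<subseteq> I \<Longrightarrow> \<not> N2 H \<Longrightarrow> prob p I (\<lambda>G. R1 G H) \<le> 1 / 4"
    and R2: "\<And>G. G \<subseteq> I \<Longrightarrow> \<not> N1 G \<Longrightarrow> prob p I (\<lambda>H. R2 G H) \<le> 1 / 4"
  obtains G H where "G \<subseteq> I" "H \<subseteq> I" "\<not> R1 G H" "\<not> R2 G H"
proof -
  let ?b = "\<lambda>Q. of_bool Q :: real"
  have "\<exists>G H. G \<subseteq> I \<and> H \<subseteq> I \<and> \<not> R1 G H \<and> \<not> R2 G H"
  proof (rule ccontr)
    assume "\<not> ?thesis"
    then have all: "R1 G H \<or> R2 G H" if "G \<subseteq> I" "H \<subseteq> I" for G H using that by blast
    have "1 = expec p I (\<lambda>G. expec p I (\<lambda>H. 1))" using I by (simp add: expec_const)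
    also have "\<dots> \<le> expec p I (\<lambda>G. expec p I (\<lambda>H. ?b (N1 G) + ?b (N2 H)
      + (?b (\<not> N2 H \<and> R1 G H) + ?b (\<not> N1 G \<and> R2 G H))))"
    proof (intro expec_mono[OF p])
      fix G H assume "G \<subseteq> I" "H \<subseteq> I"
      from all[OF this] show "1 \<le> ?b (N1 G) + ?b (N2 H) + (?b (\<not> N2 H \<and> R1 G H) + ?b (\<not> N1 G \<and> R2 G H))"
        by auto
    qed
    also have "\<dots> = prob p I N1 + prob p I N2 + (expec p I (\<lambda>H. prob p I (\<lambda>G. \<not> N2 H \<and> R1 G H))
      + expec p I (\<lambda>G. prob p I (\<lambda>H. \<not> N1 G \<and> R2 G H)))"
      unfolding expec_add prob_def expec_const[OF I]
      by (subst (3) expec_swap) simp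
    also have "expec p I (\<lambda>H. prob p I (\<lambda>G. \<not> N2 H \<and> R1 G H)) \<le> expec p I (\<lambda>H. 1 / 4)"
    proof (intro expec_mono[OF p])
      fix H assume "H \<subseteq> I"
      then show "prob p I (\<lambda>G. \<not> N2 H \<and> R1 G H) \<le> 1 / 4"
        using R1[of H] I by (cases "N2 H") (simp_all add: prob_def expec_const)
    qed
    also have "expec p I (\<lambda>G. prob p I (\<lambda>H. \<not> N1 G \<and> R2 G H)) \<le> expec p I (\<lambda>G. 1 / 4)"
    proof (intro expec_mono[OF p])
      fix G assume "G \<subseteq> I"
      then show "prob p I (\<lambda>H. \<not> N1 G \<and> R2 G H) \<le> 1 / 4"
        using R2[of G] I by (cases "N1 G") (simp_all add: prob_def expec_const)
    qed
    finally show False using N I by (simp add: expec_const)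
  qed
  with that show ?thesis by blast
qed

section \<open>The union of two blow-ups\<close>

text \<open>Were the Ramsey number at most \<open>n\<close>, the graph could be restricted to
  exactly that many vertices and relabelled by naturals, the only vertices that
  \<open>ramsey_bound\<close> speaks of.\<close>

lemma ramsey_number_greater:
  assumes fin: "finite V" and E: "E \<subseteq> [V]\<^bsup>2\<^esup>" and n: "n \<le> card V"
    and no: "\<And>R. R \<subseteq> V \<Longrightarrow> card R = l \<Longrightarrow> \<not> clique R E"
      "\<And>R. R \<subseteq> V \<Longrightarrow> card R = k \<Longrightarrow> \<not> indep R E"
  shows "n < ramsey_number l k"
proof (rule ccontr)
  let ?r = "ramsey_number l k"
  assume "\<not> n < ?r"
  then have "?r \<le> card V" using n by simp
  then obtain W where W: "W \<subseteq> V" "card W = ?r" "finite W" by (rule obtain_subset_with_card_n)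
  then obtain g where g: "bij_betw g {..<?r} W"
    using ex_bij_betw_nat_finite[of W] by (auto simp: atLeast0LessThan)
  define E' where "E' = {e \<in> [{..<?r}]\<^bsup>2\<^esup>. g ` e \<in> E}"
  obtain R where R: "R \<subseteq> {..<?r}" "card R = l \<and> clique R E' \<or> card R = k \<and> indep R E'"
    using ramsey_bound_ramsey_number[of l k] unfolding ramsey_bound_def
    by (metis (no_types, lifting) E'_def card_lessThan finite_lessThan mem_Collect_eq subsetI)
  have inj: "inj_on g R" using g R by (auto simp: bij_betw_def intro: inj_on_subset)
  have sub: "g ` R \<subseteq> V" using g R W by (auto simp: bij_betw_def)
  have edge: "{v, w} \<in> E' \<longleftrightarrow> {g v, g w} \<in> E" if "v \<in> R" "w \<in> R" "v \<noteq> w" for v w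
    using that R by (auto simp: E'_def)
  have "card (g ` R) = l \<and> clique (g ` R) E \<or> card (g ` R) = k \<and> indep (g ` R) E"
    using R(2) inj edge by (auto simp: card_image clique_def indep_def)
  then show False using no sub by blast
qed

lemma maximal_packing_triangle_free:
  assumes G: "G \<subseteq> [Y]\<^bsup>2\<^esup>"
    and max: "\<And>\<tau>. card \<tau> = 3 \<Longrightarrow> [\<tau>]\<^bsup>2\<^esup> \<subseteq> G \<Longrightarrow> [\<tau>]\<^bsup>2\<^esup> \<inter> U \<noteq> {}"
    and e: "{x, y} \<in> G - U" "{x, z} \<in> G - U" "{y, z} \<in> G - U"
  shows False
proof -
  have ne: "x \<noteq> y" "x \<noteq> z" "y \<noteq> z" using e edge_ends(3)[OF _ G] by auto
  have "[{x, y, z}]\<^bsup>2\<^esup> \<subseteq> {{x, y}, {x, z}, {y, z}}"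
    by (auto simp: nsets_2_eq doubleton_eq_iff)
  then have "[{x, y, z}]\<^bsup>2\<^esup> \<subseteq> G - U" using e by blast
  moreover have "card {x, y, z} = 3" using ne by simp
  ultimately show False using max[of "{x, y, z}"] by blast
qed

text \<open>Of the three edges of a triangle, two have the same colour; their common vertex
  witnesses a common neighbour in that colour for the third pair, which therefore
  cannot carry the other colour.\<close>

lemma two_coloured_triangle_free:
  fixes x y :: "'a \<Rightarrow> 'b"
  assumes G: "G \<subseteq> [Y]\<^bsup>2\<^esup>" "\<And>\<tau>. card \<tau> = 3 \<Longrightarrow> [\<tau>]\<^bsup>2\<^esup> \<subseteq> G \<Longrightarrow> [\<tau>]\<^bsup>2\<^esup> \<inter> U \<noteq> {}"
    and H: "H \<subseteq> [Y]\<^bsup>2\<^esup>" "\<And>\<tau>. card \<tau> = 3 \<Longrightarrow> [\<tau>]\<^bsup>2\<^esup> \<subseteq> H \<Longrightarrow> [\<tau>]\<^bsup>2\<^esup> \<inter> W \<noteq> {}"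
  defines "red v w \<equiv> {x v, x w} \<in> G - U \<and> \<not> (\<exists>z. {z, y v} \<in> H \<and> {z, y w} \<in> H)"
    and "blue v w \<equiv> {y v, y w} \<in> H - W \<and> \<not> (\<exists>z. {z, x v} \<in> G \<and> {z, x w} \<in> G)"
  assumes e: "red u v \<or> blue u v" "red u w \<or> blue u w" "red v w \<or> blue v w"
  shows False
proof -
  have red_sym: "red a b = red b a" and blue_sym: "blue a b = blue b a" for a b
    by (auto simp: red_def blue_def insert_commute)
  have 1: "\<not> blue b c" if "red a b" "red a c" for a b c
    using that unfolding red_def blue_def by blast
  have 2: "\<not> red b c" if "blue a b" "blue a c" for a b c
    using that unfolding red_def blue_def by blast
  have 3: "\<not> (red u v \<and> red u w \<and> red v w)"
    using maximal_packing_triangle_free[OF G, of "x u" "x v" "x w"] unfolding red_def by blast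
  have 4: "\<not> (blue u v \<and> blue u w \<and> blue v w)"
    using maximal_packing_triangle_free[OF H, of "y u" "y v" "y w"] unfolding blue_def by blast
  show False
    using e 1[of u v w] 1[of v u w] 1[of w u v] 2[of u v w] 2[of v u w] 2[of w u v] 3 4
    by (auto simp: red_sym[of v u] red_sym[of w u] red_sym[of w v] blue_sym[of v u] blue_sym[of w u] blue_sym[of w v])
qed

text \<open>The construction under explicit numerical conditions: \<open>spread\<close> provides the
  points, \<open>nice\<close> gives at least \<open>m\<close> open pairs in every
  \<open>a\<close>-set for either graph, and \<open>survive\<close> ensures that some open pair
  keeps its edge after the deletion.\<close>

lemma ramsey_number_3_greater:
  fixes p q T M m \<beta> \<delta> :: real and s a k n j :: nat
  defines "\<beta> \<equiv> 11 / 10 * (q * s)"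
  defines "m \<equiv> (real a)\<^sup>2 - \<beta> * a - 10 / 9 * (\<beta> * (11 / 10 * (p * s))) * a
    - 2 * T * \<beta> * M - \<delta> * (real a)\<^sup>2"
  assumes p: "0 \<le> p" "p < 1" and q: "0 \<le> q" "q \<le> 1" and as: "a \<le> s"
    and T: "0 < T" "0 < \<beta>" "p * a \<le> \<beta> / 2" "10 * a * (\<beta> * j) \<le> T\<^sup>2"
    and spread: "exp (n / 10 - 19 / 200 * (q * (real s)\<^sup>2)) + 2 * s * exp (- (q * s / 400))
      + (real (s choose a))\<^sup>2 * real (a\<^sup>2 choose k) * q ^ k < 1"
    and nice: "s * exp (- (p * s / 400)) + (real s)\<^sup>2 * (s * p\<^sup>2) ^ j
      + real n ^ a * (exp (p * (real a)\<^sup>2 - M)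
      + exp ((real a)\<^sup>2 / (T * \<beta>) * (27 * s * p\<^sup>2 - \<delta>))) < 1 / 4"
    and survive: "s * p\<^sup>2 / (1 - p) ^ 3 \<le> 1 / 10" "real n ^ a * exp (- (9 / 20 * p * m)) \<le> 1 / 4"
  shows "n < ramsey_number 3 k"
proof -
  let ?Y = "{..<s}"
  let ?I = "[?Y]\<^bsup>2\<^esup>"
  obtain V0 where V0: "V0 \<subseteq> ?Y \<times> ?Y" "n \<le> card V0"
      "\<And>u. card {v \<in> V0. fst v = u} \<le> \<beta>" "\<And>u. card {v \<in> V0. snd v = u} \<le> \<beta>"
      "\<And>S. S \<subseteq> V0 \<Longrightarrow> card S = k \<Longrightarrow> a \<le> card (fst ` S) \<or> a \<le> card (snd ` S)"
    using exists_spread_points[OF q as spread] unfolding \<beta>_def by blast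
  \<comment> \<open>Trimming to exactly \<open>n\<close> points keeps the fibre bounds and makes the
    union bounds cost \<open>n ^ a\<close>.\<close>
  obtain V where V: "V \<subseteq> V0" "card V = n" "finite V" using V0(2) by (rule obtain_subset_with_card_n)
  have fV0: "finite V0" using V0(1) by (rule finite_subset) simp
  have fib: "real (card {v \<in> V. f v = u}) \<le> \<beta>" if "\<And>u. real (card {v \<in> V0. f v = u}) \<le> \<beta>" for f :: "nat \<times> nat \<Rightarrow> nat" and u
  proof -
    have "card {v \<in> V. f v = u} \<le> card {v \<in> V0. f v = u}" using V fV0 by (intro card_mono) auto
    then show ?thesis using that[of u] by linarith
  qed
  have Y: "fst ` V \<subseteq> ?Y" "snd ` V \<subseteq> ?Y" using V V0(1) by auto
  have I: "finite ?I" by (simp add: finite_imp_finite_nsets)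
  let ?max = "\<lambda>G T. edge_packing G T \<and> (\<forall>\<tau>. card \<tau> = 3 \<longrightarrow> [\<tau>]\<^bsup>2\<^esup> \<subseteq> G \<longrightarrow> [\<tau>]\<^bsup>2\<^esup> \<inter> edges_of T \<noteq> {})"
  \<comment> \<open>The packing is fixed as a function of \<open>G\<close> alone, so the event of
    being covered by it is an event about \<open>G\<close>.\<close>
  define P where "P G = (SOME T. ?max G T)" for G :: "nat set set"
  have "?max G (P G)" if G: "G \<subseteq> ?I" for G
    unfolding P_def by (rule someI_ex, rule edge_packing_maximal[OF G finite_lessThan])
  then have P: "\<And>G. G \<subseteq> ?I \<Longrightarrow> edge_packing G (P G)"
    "\<And>G \<tau>. G \<subseteq> ?I \<Longrightarrow> card \<tau> = 3 \<Longrightarrow> [\<tau>]\<^bsup>2\<^esup> \<subseteq> G \<Longrightarrow> [\<tau>]\<^bsup>2\<^esup> \<inter> edges_of (P G) \<noteq> {}"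
    by blast+
  define bad where "bad x y G H \<longleftrightarrow> (\<exists>S\<in>[V]\<^bsup>a\<^esup>. inj_on x S \<and>
      (\<lambda>(v, w). {x v, x w}) ` open_pairs H y S \<inter> G \<subseteq> edges_of (P G))"
    for x y :: "nat \<times> nat \<Rightarrow> nat" and G H
  let ?few = "\<lambda>y G. \<exists>S\<in>[V]\<^bsup>a\<^esup>. card (open_pairs G y S) < m"
  have few: "prob p ?I (?few y) < 1 / 4"
    if "y ` V \<subseteq> ?Y" "\<And>u. real (card {v \<in> V. y v = u}) \<le> \<beta>" for y
    using prob_few_open_pairs[of p ?Y V y \<beta> T a j M \<delta>] p that V T nice by (simp add: m_def)
  have surv: "prob p ?I (\<lambda>G. bad f g G H) \<le> 1 / 4" if "f ` V \<subseteq> ?Y" "\<not> ?few g H" for f g H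
    using prob_no_surviving_edge[of p ?Y V f P a m H g] p that V P survive
    unfolding bad_def by (auto simp: not_less)
  have N: "prob p ?I (?few fst) < 1 / 4" "prob p ?I (?few snd) < 1 / 4"
    by (rule few; use Y fib V0 in blast)+
  have R: "prob p ?I (\<lambda>G. bad fst snd G H) \<le> 1 / 4" if "H \<subseteq> ?I" "\<not> ?few snd H" for H
    using Y(1) that(2) by (rule surv)
  have R': "prob p ?I (\<lambda>H. bad snd fst H G) \<le> 1 / 4" if "G \<subseteq> ?I" "\<not> ?few fst G" for G
    using Y(2) that(2) by (rule surv)
  have p': "p \<le> 1" using p by simp
  obtain G H where GH: "G \<subseteq> ?I" "H \<subseteq> ?I" "\<not> bad fst snd G H" "\<not> bad snd fst H G"
    by (rule exists_independent_pair[OF I p(1) p' N R R'])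
  define red where "red v w \<longleftrightarrow> {fst v, fst w} \<in> G - edges_of (P G) \<and>
      \<not> (\<exists>z. {z, snd v} \<in> H \<and> {z, snd w} \<in> H)" for v w :: "nat \<times> nat"
  define blue where "blue v w \<longleftrightarrow> {snd v, snd w} \<in> H - edges_of (P H) \<and>
      \<not> (\<exists>z. {z, fst v} \<in> G \<and> {z, fst w} \<in> G)" for v w :: "nat \<times> nat"
  define E where "E = {{v, w} | v w. v \<in> V \<and> w \<in> V \<and> v \<noteq> w \<and> (red v w \<or> blue v w)}"
  have E: "{v, w} \<in> E \<longleftrightarrow> v \<in> V \<and> w \<in> V \<and> v \<noteq> w \<and> (red v w \<or> blue v w)" for v w
  proof -
    have "red w v = red v w" "blue w v = blue v w" for v w
      by (auto simp: red_def blue_def insert_commute)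
    then show ?thesis unfolding E_def mem_Collect_eq doubleton_eq_iff by blast
  qed
  show ?thesis
  proof (rule ramsey_number_greater)
    show "finite V" "n \<le> card V" using V by auto
    show "E \<subseteq> [V]\<^bsup>2\<^esup>" by (auto simp: E_def)
    show "\<not> clique R E" if R: "R \<subseteq> V" "card R = 3" for R
    proof
      assume cl: "clique R E"
      obtain u v w where uvw: "R = {u, v, w}" "u \<noteq> v" "u \<noteq> w" "v \<noteq> w"
        using R by (auto simp: card_3_iff)
      then have "{u, v} \<in> E" "{u, w} \<in> E" "{v, w} \<in> E" using cl by (auto simp: clique_def)
      then show False
        using two_coloured_triangle_free[OF GH(1) P(2)[OF GH(1)] GH(2) P(2)[OF GH(2)], of fst u v snd w]
        unfolding E red_def blue_def by blast
    qed
    show "\<not> indep S E" if S: "S \<subseteq> V" "card S = k" for S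
    proof
      assume ind: "indep S E"
      have main: "\<exists>v\<in>S. \<exists>w\<in>S. v \<noteq> w \<and> {x v, x w} \<in> G' - edges_of (P G') \<and> \<not> (\<exists>z. {z, y v} \<in> H' \<and> {z, y w} \<in> H')"
        if ge: "a \<le> card (x ` S)" and nb: "\<not> bad x y G' H'" for x y G' H'
      proof -
        \<comment> \<open>One representative is taken for each of \<open>a\<close> values of
          \<open>x\<close>, which makes \<open>x\<close> injective on \<open>S'\<close> as
          \<open>bad\<close> requires.\<close>
        obtain A where A: "A \<subseteq> x ` S" "card A = a" "finite A" using ge by (rule obtain_subset_with_card_n)
        then obtain S' where S': "S' \<subseteq> S" "inj_on x S'" "A = x ` S'" by (auto simp: subset_image_inj)
        have "S' \<in> [V]\<^bsup>a\<^esup>"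
          using S' S A V by (auto simp: nsets_def card_image intro: finite_subset)
        with nb S'(2) have "\<not> (\<lambda>(v, w). {x v, x w}) ` open_pairs H' y S' \<inter> G' \<subseteq> edges_of (P G')"
          unfolding bad_def by blast
        then obtain e where e: "e \<in> (\<lambda>(v, w). {x v, x w}) ` open_pairs H' y S'" "e \<in> G' - edges_of (P G')"
          by blast
        from e(1) obtain v w where vw: "(v, w) \<in> open_pairs H' y S'" "e = {x v, x w}" by auto
        have "v \<in> S" "w \<in> S" "v \<noteq> w" "\<not> (\<exists>z. {z, y v} \<in> H' \<and> {z, y w} \<in> H')"
          using vw(1) S'(1) by (auto simp: open_pairs_def)
        then show ?thesis using e(2) vw(2) by blast
      qed
      have "a \<le> card (fst ` S) \<or> a \<le> card (snd ` S)" using V0(5)[of S] S V by auto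
      then have "\<exists>v\<in>S. \<exists>w\<in>S. v \<noteq> w \<and> (red v w \<or> blue v w)"
        using main[of fst snd G H] main[of snd fst H G] GH unfolding red_def blue_def by blast
      then show False using ind S unfolding indep_def by (meson E subsetD)
    qed
  qed
qed

section \<open>Asymptotics\<close>

text \<open>Here \<open>S\<close>, \<open>A\<close>, \<open>C\<close> are \<open>s\<close>, \<open>a\<close> up to rounding and \<open>b = q s\<close> is the expected number of points on a line of
  the grid. The exponent of \<open>b\<close> must be positive, to make \<open>s p\<^sup>2\<close> a negative power of \<open>k\<close>, but below 1/11:
  the number of pairs of \<open>a\<close>-sets grows like \<open>(k / b) ^ (9 k / 10)\<close> and their product
  contains \<open>k\<close> of the points with probability about \<open>(b\<^sup>2 / k) ^ k\<close>.\<close>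

lemma ramsey_number_3_ge:
  fixes k :: nat and x L S b p A C :: real
  assumes defs: "x = real k" "L = ln x" "S = 11 / 2000 * x powr (39 / 20) / L" "b = x powr (1 / 20)"
      "p = 28 * L / x" "A = 9 / 20 * x + 1" "C = 9 / 20 * x"
    and f: "1 \<le> L" "20 \<le> x" "p \<le> 1 / 2" "b \<le> S" "A \<le> S" "p * A \<le> 11 / 20 * b"
    and spread: "exp (- (9 / 400000 * x\<^sup>2 / L)) \<le> 1 / 8" "2 * (S + 1) * exp (- (b / 400)) \<le> 1 / 8"
      "exp (2 * A * (1 + ln ((S + 1) / C)) + x * (1 + ln (A\<^sup>2 / x)) + x * ln (b / S)) \<le> 1 / 8"
    and nice: "(S + 1) * exp (- (p * S / 400)) \<le> 1 / 16" "(S + 1)\<^sup>2 * ((S + 1) * p\<^sup>2) ^ 100 \<le> 1 / 16"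
      "exp (- (2 * x * L)) \<le> 1 / 16" "27 * (S + 1) * p\<^sup>2 \<le> 1 / 200"
      "exp (2 * L * A - C\<^sup>2 / (sqrt (1100 * (A * b)) * (11 / 10 * b)) / 200) \<le> 1 / 32"
    and survive: "8 * (S + 1) * p\<^sup>2 \<le> 1 / 10"
      "11 / 10 * b * A + 121 / 90 * (77 / 500 * x + p * b) * A
        + 2 * sqrt (1100 * (A * b)) * (11 / 10 * b) * (10 * (x * L)) \<le> 1 / 10 * x\<^sup>2"
      "exp (2 * L * A - 9 / 20 * p * (x\<^sup>2 / 10)) \<le> 1 / 4"
  shows "x\<^sup>2 / (200 * L) \<le> ramsey_number 3 k"
proof -
  define s where "s = nat \<lceil>S\<rceil>"
  define a where "a = nat \<lceil>C\<rceil>"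
  define n where "n = nat \<lfloor>x\<^sup>2 / (200 * L)\<rfloor>"
  define q where "q = b / s"
  \<comment> \<open>The smallest \<open>T\<close> allowed by the near-disjointness condition: 1100
    is 10 times 11/10 times the codegree threshold 100.\<close>
  define T where "T = sqrt (1100 * (a * b))"
  \<comment> \<open>In units of \<open>x * L\<close>, the choice of sets contributes at most 1 and
    \<open>p * a^2\<close> at most 7 to the exponent, so subtracting 10 leaves -2.\<close>
  define M where "M = 10 * (x * L)"
  have pos: "0 < x" "0 < L" "0 < b" "0 < p" "0 < C" "0 < A" "0 < S"
    using f defs by auto
  have s: "S \<le> s" "s \<le> S + 1" unfolding s_def using pos by linarith+
  have a: "C \<le> a" "a \<le> A" unfolding a_def using pos defs by linarith+
  have n: "n \<le> x\<^sup>2 / (200 * L)" "x\<^sup>2 / (200 * L) \<le> n + 1"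
  proof -
    have "0 \<le> x\<^sup>2 / (200 * L)" using pos by simp
    then show "n \<le> x\<^sup>2 / (200 * L)" "x\<^sup>2 / (200 * L) \<le> n + 1" unfolding n_def by linarith+
  qed
  have pos': "0 < real s" "0 < real a" using s a pos by linarith+
  have qs: "q * s = b" using pos' by (simp add: q_def)
  \<comment> \<open>\<open>b * S\<close> is the expected number of points up to rounding; 11/2000
    exceeds the target 1/200 by ten percent, the room for the lower tail.\<close>
  have bS: "b * S = 11 / 2000 * x\<^sup>2 / L"
  proof -
    have "x powr (1 / 20) * x powr (39 / 20) = x powr 2" by (simp flip: powr_add)
    also have "\<dots> = x\<^sup>2" using pos by simp
    finally show ?thesis unfolding defs(3,4) by simp
  qed
  have q01: "0 \<le> q" "q \<le> 1" using pos pos' f s by (auto simp: q_def)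
  have A_le: "A \<le> x / 2" using f defs by simp
  have T0: "0 < T" using pos pos' by (simp add: T_def)
  have T_le: "T \<le> sqrt (1100 * (A * b))" using a pos by (simp add: T_def)
  have n_pow: "real n ^ a \<le> exp (2 * L * A)"
  proof -
    have "x\<^sup>2 / (200 * L) \<le> x\<^sup>2 / 1" using f by (intro divide_left_mono) auto
    then have "real n \<le> x\<^sup>2" using n by simp
    also have "x\<^sup>2 = exp (2 * L)" using pos defs by (simp add: exp_double)
    finally have "real n ^ a \<le> exp (2 * L) ^ a" by (intro power_mono) auto
    also have "\<dots> = exp (2 * L * a)" by (simp add: exp_of_nat2_mult)
    also have "\<dots> \<le> exp (2 * L * A)" using a pos by simp
    finally show ?thesis .
  qed
  have pk: "x * p = 28 * L" using pos defs by simp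
  have "n < ramsey_number 3 k"
  \<comment> \<open>Up to logarithms \<open>s * p^2\<close> is \<open>x\<close> to the power -1/20
    and \<open>s^2\<close> is \<open>x\<close> to the power 39/10, so any codegree threshold above
    78 would do. Half of \<open>\<delta>\<close> = 1/100 is left after subtracting the mean
    term.\<close>
  proof (rule ramsey_number_3_greater[where p = p and q = q and T = T and M = M and \<delta> = "1 / 100" and s = s and a = a and j = 100])
    show "0 \<le> p" "p < 1" "0 \<le> q" "q \<le> 1" "0 < T" using pos f q01 T0 by auto
    show "a \<le> s" using a s f by linarith
    show "0 < 11 / 10 * (q * s)" using qs pos by simp
    show "p * a \<le> 11 / 10 * (q * s) / 2"
      using mult_left_mono[OF a(2), of p] pos(4) f(6) unfolding qs by linarith
    show "10 * a * (11 / 10 * (q * s) * real 100) \<le> T\<^sup>2"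
      unfolding qs T_def using pos by simp
    show "exp (n / 10 - 19 / 200 * (q * (real s)\<^sup>2)) + 2 * s * exp (- (q * s / 400))
      + (real (s choose a))\<^sup>2 * real (a\<^sup>2 choose k) * q ^ k < 1"
    proof -
      have "b * S \<le> b * s" using s pos by simp
      also have "b * s = q * (real s)\<^sup>2" using qs by (simp add: power2_eq_square flip: mult.assoc)
      finally have "11 / 2000 * x\<^sup>2 / L \<le> q * (real s)\<^sup>2" unfolding bS .
      then have "n / 10 - 19 / 200 * (q * (real s)\<^sup>2) \<le> (x\<^sup>2 / (200 * L)) / 10 - 19 / 200 * (11 / 2000 * x\<^sup>2 / L)"
        using n(1) by (intro diff_mono divide_right_mono mult_left_mono) auto
      also have "\<dots> = - (9 / 400000 * x\<^sup>2 / L)" using pos by (simp add: field_simps)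
      finally have 1: "exp (n / 10 - 19 / 200 * (q * (real s)\<^sup>2)) \<le> 1 / 8"
        using spread(1) by (meson exp_le_cancel_iff order_trans)
      have 2: "2 * s * exp (- (q * s / 400)) \<le> 1 / 8"
        using spread(2) s unfolding qs by (elim order_trans[rotated]) (intro mult_right_mono, auto)
      \<comment> \<open>Makes the logarithm nonnegative, so that \<open>a\<close> may be replaced by
        \<open>A\<close> in the exponent.\<close>
      have C1: "1 \<le> (S + 1) / C" using f defs pos by simp
      have "real (s choose a) \<le> (exp 1 * s / a) ^ a" by (rule choose_le)
      also have "\<dots> \<le> (exp 1 * ((S + 1) / C)) ^ a"
        unfolding times_divide_eq_right[symmetric] using s a pos pos'
        by (intro power_mono mult_left_mono frac_le) auto
      also have "\<dots> = exp (a * (1 + ln ((S + 1) / C)))"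
        using C1 by (simp add: exp_of_nat_mult exp_add)
      also have "\<dots> \<le> exp (A * (1 + ln ((S + 1) / C)))"
        using a C1 by (simp add: mult_right_mono)
      finally have "(real (s choose a))\<^sup>2 \<le> (exp (A * (1 + ln ((S + 1) / C))))\<^sup>2"
        by (intro power_mono) auto
      also have "\<dots> = exp (2 * A * (1 + ln ((S + 1) / C)))" by (simp flip: exp_double add: mult.assoc)
      finally have c1: "(real (s choose a))\<^sup>2 \<le> exp (2 * A * (1 + ln ((S + 1) / C)))" .
      have "real (a\<^sup>2 choose k) \<le> (exp 1 * real (a\<^sup>2) / k) ^ k" by (rule choose_le)
      also have "\<dots> \<le> (exp 1 * (A\<^sup>2 / x)) ^ k"
        unfolding times_divide_eq_right[symmetric] using a pos pos'
        by (intro power_mono mult_left_mono) (auto simp: defs(1) intro!: divide_right_mono power_mono)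
      also have "\<dots> = exp (x * (1 + ln (A\<^sup>2 / x)))"
        using pos by (simp add: defs(1) exp_of_nat_mult exp_add)
      finally have c2: "real (a\<^sup>2 choose k) \<le> exp (x * (1 + ln (A\<^sup>2 / x)))" .
      have "q ^ k \<le> (b / S) ^ k"
        unfolding q_def using s pos pos' by (intro power_mono divide_left_mono) auto
      also have "\<dots> = exp (x * ln (b / S))" using pos by (simp add: defs(1) exp_of_nat_mult)
      finally have c3: "q ^ k \<le> exp (x * ln (b / S))" .
      have "(real (s choose a))\<^sup>2 * real (a\<^sup>2 choose k) * q ^ k
        \<le> exp (2 * A * (1 + ln ((S + 1) / C))) * exp (x * (1 + ln (A\<^sup>2 / x))) * exp (x * ln (b / S))"
        using c1 c2 c3 q01 by (intro mult_mono) auto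
      also have "\<dots> \<le> 1 / 8" using spread(3) by (simp flip: exp_add)
      finally show ?thesis using 1 2 by linarith
    qed
    show "s * exp (- (p * s / 400)) + (real s)\<^sup>2 * (s * p\<^sup>2) ^ 100
      + real n ^ a * (exp (p * (real a)\<^sup>2 - M)
      + exp ((real a)\<^sup>2 / (T * (11 / 10 * (q * s))) * (real (27 * s) * p\<^sup>2 - 1 / 100))) < 1 / 4"
    proof -
      have "s * exp (- (p * s / 400)) \<le> (S + 1) * exp (- (p * S / 400))"
        using s pos by (intro mult_mono) auto
      then have 1: "s * exp (- (p * s / 400)) \<le> 1 / 16" using nice(1) by linarith
      have "(real s)\<^sup>2 * (s * p\<^sup>2) ^ 100 \<le> (S + 1)\<^sup>2 * ((S + 1) * p\<^sup>2) ^ 100"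
        using s pos by (intro mult_mono power_mono mult_right_mono) auto
      then have 2: "(real s)\<^sup>2 * (s * p\<^sup>2) ^ 100 \<le> 1 / 16" using nice(2) by linarith
      have "real n ^ a * exp (p * (real a)\<^sup>2 - M) \<le> exp (2 * L * A) * exp (p * (real a)\<^sup>2 - M)"
        using n_pow by (intro mult_right_mono) auto
      also have "\<dots> = exp (2 * L * A + (p * (real a)\<^sup>2 - M))" by (simp add: exp_add)
      also have "\<dots> \<le> exp (- (2 * x * L))"
      proof -
        have "real a \<le> x / 2" using a A_le by linarith
        then have "(real a)\<^sup>2 \<le> (x / 2)\<^sup>2" by (intro power_mono) auto
        then have "p * (real a)\<^sup>2 \<le> p * (x / 2)\<^sup>2" using pos by (intro mult_left_mono) auto
        also have "\<dots> = 7 * (x * L)" using pk by (simp add: power2_eq_square) (simp add: algebra_simps)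
        finally have "p * (real a)\<^sup>2 \<le> 7 * (x * L)" .
        moreover have "2 * L * A \<le> x * L" using mult_left_mono[OF A_le, of "2 * L"] pos by (simp add: mult_ac)
        ultimately show ?thesis unfolding M_def exp_le_cancel_iff by argo
      qed
      finally have 3: "real n ^ a * exp (p * (real a)\<^sup>2 - M) \<le> 1 / 16" using nice(3) by linarith
      let ?D = "(real a)\<^sup>2 / (T * (11 / 10 * b))"
      let ?D' = "C\<^sup>2 / (sqrt (1100 * (A * b)) * (11 / 10 * b))"
      have "?D' \<le> ?D"
        using a pos T0 T_le by (intro frac_le power_mono mult_right_mono) auto
      have "real (27 * s) * p\<^sup>2 \<le> 27 * (S + 1) * p\<^sup>2" using s by (intro mult_right_mono) auto
      then have "real (27 * s) * p\<^sup>2 - 1 / 100 \<le> - (1 / 200)" using nice(4) by linarith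
      then have "?D * (real (27 * s) * p\<^sup>2 - 1 / 100) \<le> ?D * - (1 / 200)"
        using pos T0 by (intro mult_left_mono) auto
      also have "\<dots> \<le> - (?D' / 200)"
      proof -
        have "d * - (1 / 200) \<le> - (d' / 200)" if "d' \<le> d" for d d' :: real using that by simp
        then show ?thesis using \<open>?D' \<le> ?D\<close> .
      qed
      finally have "real n ^ a * exp (?D * (real (27 * s) * p\<^sup>2 - 1 / 100)) \<le> exp (2 * L * A) * exp (- (?D' / 200))"
        using n_pow by (intro mult_mono) auto
      also have "\<dots> \<le> 1 / 32" using nice(5) by (simp flip: exp_add)
      finally have 4: "real n ^ a * exp (?D * (real (27 * s) * p\<^sup>2 - 1 / 100)) \<le> 1 / 32" .
      show ?thesis unfolding qs distrib_left using 1 2 3 4 by linarith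
    qed
    show "s * p\<^sup>2 / (1 - p) ^ 3 \<le> 1 / 10"
    proof -
      have "(1 / 2) ^ 3 \<le> (1 - p) ^ 3" using f by (intro power_mono) auto
      then have "s * p\<^sup>2 / (1 - p) ^ 3 \<le> (S + 1) * p\<^sup>2 / (1 / 2) ^ 3"
        using s pos by (intro frac_le mult_right_mono) auto
      also have "\<dots> = 8 * (S + 1) * p\<^sup>2" by (simp add: power3_eq_cube)
      finally show ?thesis using survive(1) by linarith
    qed
    let ?m = "(real a)\<^sup>2 - 11 / 10 * (q * s) * a - 10 / 9 * (11 / 10 * (q * s) * (11 / 10 * (p * s))) * a
      - 2 * T * (11 / 10 * (q * s)) * M - 1 / 100 * (real a)\<^sup>2"
    \<comment> \<open>The main term is at least 2/10 of the square of \<open>x\<close>, as 99/100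
      times 81/400 exceeds 1/5; all losses together take at most 1/10.\<close>
    have m: "x\<^sup>2 / 10 \<le> ?m"
    proof -
      have "C\<^sup>2 \<le> (real a)\<^sup>2" using a pos by (intro power_mono) auto
      moreover have "C\<^sup>2 = 81 / 400 * x\<^sup>2" by (simp add: defs(7) power2_eq_square)
      moreover have "0 \<le> x\<^sup>2" by simp
      ultimately have "2 / 10 * x\<^sup>2 \<le> 99 / 100 * (real a)\<^sup>2" by linarith
      moreover have "11 / 10 * b * a \<le> 11 / 10 * b * A" using a pos by simp
      moreover have "10 / 9 * (11 / 10 * b * (11 / 10 * (p * s))) * a \<le> 121 / 90 * (77 / 500 * x + p * b) * A"
      proof -
        have "b * (p * s) \<le> b * (p * (S + 1))" using s pos by (intro mult_left_mono) auto
        also have "\<dots> = p * (b * S) + p * b" by (simp add: algebra_simps)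
        also have "p * (b * S) = 77 / 500 * x"
          unfolding bS defs(5) using pos by (simp add: field_simps power2_eq_square)
        finally have "b * (p * s) \<le> 77 / 500 * x + p * b" .
        then have "121 / 90 * (b * (p * s)) * a \<le> 121 / 90 * (77 / 500 * x + p * b) * A"
          using a pos by (intro mult_mono) auto
        then show ?thesis by (simp add: mult_ac)
      qed
      moreover have "2 * T * (11 / 10 * b) * M \<le> 2 * sqrt (1100 * (A * b)) * (11 / 10 * b) * (10 * (x * L))"
        unfolding M_def using T_le pos by (intro mult_right_mono mult_left_mono) auto
      ultimately show ?thesis unfolding qs using survive(2) by linarith
    qed
    have "real n ^ a * exp (- (9 / 20 * p * ?m)) \<le> exp (2 * L * A) * exp (- (9 / 20 * p * (x\<^sup>2 / 10)))"
      using n_pow mult_left_mono[OF m, of "9 / 20 * p"] pos by (intro mult_mono) auto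
    also have "\<dots> \<le> 1 / 4" using survive(3) by (simp flip: exp_add)
    finally show "real n ^ a * exp (- (9 / 20 * p * ?m)) \<le> 1 / 4" .
  qed
  \<comment> \<open>The strict inequality between integers makes up for rounding \<open>n\<close>
    down.\<close>
  then show ?thesis using n(2) by linarith
qed

theorem theorem1p2:
  shows "\<exists>\<epsilon> :: nat \<Rightarrow> real. \<epsilon> \<longlonglongrightarrow> 0 \<and>
    (\<forall>\<^sub>F k in sequentially.
       real (ramsey_number 3 k) \<ge> (1 / 200 + \<epsilon> k) * ((real k)\<^sup>2 / ln (real k)))"
proof (intro exI[of _ "\<lambda>_. 0"] conjI)
  \<comment> \<open>The error term is taken to be 0: the slack in the constants absorbs all lower
    order terms, so the bound holds with 1/200 itself for large \<open>k\<close>.\<close>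
  let ?S = "\<lambda>k :: nat. 11 / 2000 * real k powr (39 / 20) / ln (real k)"
  let ?p = "\<lambda>k :: nat. 28 * ln (real k) / real k"
  let ?b = "\<lambda>k :: nat. real k powr (1 / 20)"
  let ?A = "\<lambda>k :: nat. 9 / 20 * real k + 1"
  let ?C = "\<lambda>k :: nat. 9 / 20 * real k"
  have "\<forall>\<^sub>F k in sequentially. 1 \<le> ln (real k)"
    by real_asymp
  moreover have "\<forall>\<^sub>F k in sequentially. 20 \<le> real k"
    by real_asymp
  moreover have "\<forall>\<^sub>F k in sequentially. ?p k \<le> 1 / 2"
    by real_asymp
  moreover have "\<forall>\<^sub>F k in sequentially. ?b k \<le> ?S k"
    by real_asymp
  moreover have "\<forall>\<^sub>F k in sequentially. ?A k \<le> ?S k"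
    by real_asymp
  moreover have "\<forall>\<^sub>F k in sequentially. ?p k * ?A k \<le> 11 / 20 * ?b k"
    by real_asymp
  moreover have "\<forall>\<^sub>F k in sequentially. exp (- (9 / 400000 * (real k)\<^sup>2 / ln (real k))) \<le> 1 / 8"
    by real_asymp
  moreover have "\<forall>\<^sub>F k in sequentially. 2 * (?S k + 1) * exp (- (?b k / 400)) \<le> 1 / 8"
    by real_asymp
  \<comment> \<open>The coefficients of \<open>k * ln k\<close> are 9/10 times 19/20, then 1, then
    -19/10, with sum -9/200.\<close>
  moreover have "\<forall>\<^sub>F k in sequentially. exp (2 * ?A k * (1 + ln ((?S k + 1) / ?C k)) + real k * (1 + ln ((?A k)\<^sup>2 / real k)) + real k * ln (?b k / ?S k)) \<le> 1 / 8"
    by real_asymp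
  moreover have "\<forall>\<^sub>F k in sequentially. (?S k + 1) * exp (- (?p k * ?S k / 400)) \<le> 1 / 16"
    by real_asymp
  moreover have "\<forall>\<^sub>F k in sequentially. (?S k + 1)\<^sup>2 * ((?S k + 1) * (?p k)\<^sup>2) ^ 100 \<le> 1 / 16"
    by real_asymp
  moreover have "\<forall>\<^sub>F k in sequentially. exp (- (2 * real k * ln (real k))) \<le> 1 / 16"
    by real_asymp
  moreover have "\<forall>\<^sub>F k in sequentially. 27 * (?S k + 1) * (?p k)\<^sup>2 \<le> 1 / 200"
    by real_asymp
  moreover have "\<forall>\<^sub>F k in sequentially. exp (2 * ln (real k) * ?A k - (?C k)\<^sup>2 / (sqrt (1100 * (?A k * ?b k)) * (11 / 10 * ?b k)) / 200) \<le> 1 / 32"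
    by real_asymp
  \<comment> \<open>The subtracted term has order \<open>k\<close> to the power 57/40, which beats
    \<open>k * ln k\<close>.\<close>
  moreover have "\<forall>\<^sub>F k in sequentially. 8 * (?S k + 1) * (?p k)\<^sup>2 \<le> 1 / 10"
    by real_asymp
  \<comment> \<open>Only the heavy vertices contribute at quadratic order, with coefficient 121/90
    times 77/500 times 9/20, about 0.0932.\<close>
  moreover have "\<forall>\<^sub>F k in sequentially. 11 / 10 * ?b k * ?A k + 121 / 90 * (77 / 500 * real k + ?p k * ?b k) * ?A k + 2 * sqrt (1100 * (?A k * ?b k)) * (11 / 10 * ?b k) * (10 * (real k * ln (real k))) \<le> 1 / 10 * (real k)\<^sup>2"
    by real_asymp
  \<comment> \<open>The gain 9/20 times 28/10, that is 1.26, exceeds the cost 0.9 of choosing the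
    set, both in units of \<open>k * ln k\<close>.\<close>
  moreover have "\<forall>\<^sub>F k in sequentially. exp (2 * ln (real k) * ?A k - 9 / 20 * ?p k * ((real k)\<^sup>2 / 10)) \<le> 1 / 4"
    by real_asymp
  ultimately show "\<forall>\<^sub>F k in sequentially. real (ramsey_number 3 k) \<ge> (1 / 200 + 0) * ((real k)\<^sup>2 / ln (real k))"
  proof eventually_elim
    case (elim k)
    from ramsey_number_3_ge[OF refl refl refl refl refl refl refl elim(1-17)]
    show ?case by simp
  qed
qed simp

end
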